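(* Let $n\ge 2$, let $L\in\mathbb{R}^{n\times n}$ be the weighted Laplacian of an undirected connected graph on $\{1,\dots,n\}$ (so $L=L^\top$ and $0$ is a simple eigenvalue of $L$), let $d\in\mathbb{R}$, and let $x^0\in\mathbb{R}^n$ satisfy $\sum_{i=1}^n x_i^0=d$. Let $f_i(x_i)=\tfrac12 a_i x_i^2+b_i x_i$ with $a_i>0$, $b_i\in\mathbb{R}$, $i=1,\dots,n$, and put $H=\mathrm{diag}(a_1,\dots,a_n)$ and $g(z)=\sum_{i=1}^n f_i(x_i^0+(Lz)_i)$. Suppose there is $\epsilon<1$ such that $$-\epsilon I_{n-1}\preceq I_{n-1}-M\preceq \epsilon I_{n-1},$$ where $M\in\mathbb{R}^{(n-1)\times(n-1)}$ is the reduced Hessian defined in the context. Let $\underline{x},\overline{x}\in\mathbb{R}^n$ and $$P(z)=\begin{bmatrix}\underline{x}-x^0-Lz\\ x^0+Lz-\overline{x}\end{bmatrix}\in\mathbb{R}^{2n},$$ and suppose there exists $z\in\mathbb{R}^n$ with $P(z)\prec 0$ (every component strictly negative). Let $\mathcal{L}(z,\lambda)=g(z)+\lambda^\top P(z)$ for $z\in\mathbb{R}^n$, $\lambda\in\mathbb{R}^{2n}$, let $q$ be a nonnegative integer, and let $A_q=\sum_{p=0}^q(I_n-LHL)^p$. Consider the dynamics $$\dot z=-A_q\nabla_z\mathcal{L}(z,\lambda),\qquad \dot\lambda=\left[\nabla_\lambda\mathcal{L}(z,\lambda)\right]^+_\lambda,$$ with initial condition $z(0)\in\mathbb{R}^n$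 and $\lambda(0)\in\mathbb{R}^{2n}$ satisfying $\lambda(0)\succeq 0$ componentwise. Then the solution trajectories $(z(t),\lambda(t))$ converge asymptotically as $t\to\infty$ to an optimal point $(z^\star,\lambda^\star)$ of the problem $$\min_{z\in\mathbb{R}^n} g(z)\quad\text{subject to}\quad P(z)\preceq \mathbf{0}_{2n},$$ where $z^\star$ uniquely satisfies $\mathbf{1}_n^\top z^\star=\mathbf{1}_n^\top z(0)$.
   Context: Weighted Laplacian: for an undirected graph on nodes $\{1,\dots,n\}$ with edge weights $w_{ij}=w_{ji}>0$ for edges $\{i,j\}$, $L_{ij}=-w_{ij}$ if $j\neq i$ is a neighbor of $i$, $L_{ii}=\sum_{j}w_{ij}$ (sum over neighbors of $i$), and $L_{ij}=0$ otherwise. Thus $L\succeq 0$ and $L\mathbf{1}_n=\mathbf{0}$, where $\mathbf{1}_n$ is the all-ones vector. Reduced Hessian: let $r=1/\sqrt{n(n+1+2\sqrt n)}$ and let $U\in\mathbb{R}^{n\times(n-1)}$ have entries $U_{ii}=r(n-1+\sqrt n)$ for $1\le i\le n-1$, $U_{ij}=-r$ for $1\le i,j\le n-1$, $i\ne j$, and $U_{nj}=-r(1+\sqrt n)$ for $1\le j\le n-1$. (The columns of $U$ form an orthonormal basis of the orthogonal complement of $\mathbf{1}_n$.) Then $M:=U^\top LHLU$. Projection: for scalars $u,v$, $[u]^+_v=u$ if $v>0$ and $[u]^+_v=\max\{0,u\}$ if $v\le 0$; for vectors it is applied componentwise. Since this right-hand side is discontinuous, solutions are understood as absolutely continuous functions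 of $t\ge 0$ satisfying the differential equations for almost every $t$. Optimal point: a pair $(z^\star,\lambda^\star)\in\mathbb{R}^n\times\mathbb{R}^{2n}_{\ge 0}$ that is a saddle point of $\mathcal{L}$, i.e. $\mathcal{L}(z^\star,\lambda)\le\mathcal{L}(z^\star,\lambda^\star)\le\mathcal{L}(z,\lambda^\star)$ for all $z\in\mathbb{R}^n$ and $\lambda\in\mathbb{R}^{2n}_{\ge0}$ (equivalently, $z^\star$ and $\lambda^\star$ are primal and dual optimizers of the constrained problem). For symmetric matrices, $A\preceq B$ means $B-A$ is positive semidefinite; for vectors, $\preceq,\succeq,\prec$ are componentwise inequalities. *)

theory Defs
  imports "HOL-Analysis.Analysis"
begin

section \<open>Weighted graphs and Laplacians\<close>

text \<open>The graph has vertex set \<open>UNIV :: 'v set\<close>; an undirected edge is the pair of its two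
  orientations. Values of \<open>w\<close> off the edge set are irrelevant.\<close>

definition weighted_graph :: "('v \<times> 'v) set \<Rightarrow> ('v \<Rightarrow> 'v \<Rightarrow> real) \<Rightarrow> bool" where
  "weighted_graph E w \<longleftrightarrow> sym E \<and> irrefl E \<and> (\<forall>(i, j)\<in>E. w i j = w j i \<and> 0 < w i j)"

definition graph_connected :: "('v \<times> 'v) set \<Rightarrow> bool" where
  "graph_connected E \<longleftrightarrow> (\<forall>i j. (i, j) \<in> E\<^sup>*)"

definition laplacian :: "('v::finite \<times> 'v) set \<Rightarrow> ('v \<Rightarrow> 'v \<Rightarrow> real) \<Rightarrow> real^'v^'v" where
  "laplacian E w =
     (\<chi> i j. if i = j then (\<Sum>k | (i, k) \<in> E. w i k) else if (i, j) \<in> E then - w i j else 0)"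


section \<open>Matrices\<close>

definition diag_mat :: "real^'v \<Rightarrow> real^'v^'v" where
  "diag_mat a = (\<chi> i j. if i = j then a $ i else 0)"

text \<open>The operation \<open>^\<close> on \<open>real^'v^'v\<close> is the componentwise power, so the power with
  respect to \<open>**\<close> is defined separately.\<close>

primrec mat_pow :: "real^'v^'v \<Rightarrow> nat \<Rightarrow> real^'v^'v" where
  "mat_pow A 0 = mat 1"
| "mat_pow A (Suc p) = A ** mat_pow A p"

definition psd :: "real^'v^'v \<Rightarrow> bool" where
  "psd A \<longleftrightarrow> transpose A = A \<and> (\<forall>x. 0 \<le> x \<bullet> (A *v x))"

definition loewner_le :: "real^'v^'v \<Rightarrow> real^'v^'v \<Rightarrow> bool"  (infix \<open>\<preceq>\<^sub>L\<close> 50) where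
  "A \<preceq>\<^sub>L B \<longleftrightarrow> psd (B - A)"

text \<open>To have both an \<open>n\<close>-element and an \<open>(n - 1)\<close>-element index type, the nodes
  \<open>1, \<dots>, n - 1\<close> are the elements \<open>Some k\<close> of \<open>'m option\<close> and node \<open>n\<close> is \<open>None\<close>. Thus
  \<open>n = CARD('m option) = CARD('m) + 1\<close> is an arbitrary integer \<open>\<ge> 2\<close>.\<close>

definition ortho_basis :: "real^'m^('m::finite option)" where
  "ortho_basis =
     (let n = real CARD('m option); r = 1 / sqrt (n * (n + 1 + 2 * sqrt n)) in
      (\<chi> i j. case i of
           None \<Rightarrow> - r * (1 + sqrt n)
         | Some k \<Rightarrow> if k = j then r * (n - 1 + sqrt n) else - r))"

definition reduced_hessian ::
    "real^('m::finite option)^('m option) \<Rightarrow> real^('m option)^('m option) \<Rightarrow> real^'m^'m" where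
  "reduced_hessian L H = transpose ortho_basis ** L ** H ** L ** ortho_basis"


section \<open>Constrained problems and their Lagrangians\<close>

definition lagrangian :: "('a \<Rightarrow> real) \<Rightarrow> ('a \<Rightarrow> real^'k) \<Rightarrow> 'a \<Rightarrow> real^'k \<Rightarrow> real" where
  "lagrangian g P z lam = g z + lam \<bullet> P z"

text \<open>The strict order \<open><\<close> on \<open>real^'k\<close> is not the componentwise strict order; vector
  inequalities are therefore written out in components throughout.\<close>

definition optimal_point :: "('a \<Rightarrow> real) \<Rightarrow> ('a \<Rightarrow> real^'k) \<Rightarrow> 'a \<Rightarrow> real^'k \<Rightarrow> bool" where
  "optimal_point g P zs ls \<longleftrightarrow>
     (\<forall>k. 0 \<le> ls $ k) \<and>
     (\<forall>lam. (\<forall>k. 0 \<le> lam $ k) \<longrightarrow> lagrangian g P zs lam \<le> lagrangian g P zs ls) \<and>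
     (\<forall>z. lagrangian g P zs ls \<le> lagrangian g P z ls)"


section \<open>Projected primal-dual dynamics\<close>

definition grad :: "('a::real_inner \<Rightarrow> real) \<Rightarrow> 'a \<Rightarrow> 'a" where
  "grad f x = (THE D. GDERIV f x :> D)"

lemma grad_eq:
  assumes "GDERIV f x :> D"
  shows "grad f x = D"
  unfolding grad_def
proof (rule the_equality, rule assms)
  fix D' assume "GDERIV f x :> D'"
  with assms have "(\<lambda>h. h \<bullet> D') = (\<lambda>h. h \<bullet> D)"
    unfolding gderiv_def by (blast intro: has_derivative_unique)
  then show "D' = D"
    by (metis vector_eq_ldot)
qed

definition pos_proj :: "real^'k \<Rightarrow> real^'k \<Rightarrow> real^'k" where
  "pos_proj u v = (\<chi> k. if v $ k > 0 then u $ k else max 0 (u $ k))"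

text \<open>Absolute continuity of a function on a set of reals: \<open>D\<close> ranges over the finite families
  of non-overlapping compact intervals \<open>{Inf K..Sup K}\<close> contained in \<open>S\<close>.\<close>

definition abs_continuous_on :: "real set \<Rightarrow> (real \<Rightarrow> 'b::real_normed_vector) \<Rightarrow> bool" where
  "abs_continuous_on S f \<longleftrightarrow>
     (\<forall>e>0. \<exists>d>0. \<forall>D T. D division_of T \<and> T \<subseteq> S \<and> (\<Sum>K\<in>D. Sup K - Inf K) < d \<longrightarrow>
        (\<Sum>K\<in>D. norm (f (Sup K) - f (Inf K))) < e)"

text \<open>Caratheodory solutions on \<open>[0, \<infinity>)\<close> of \<open>z' = - A \<nabla>\<^sub>z Lag\<close>,
  \<open>lam' = [\<nabla>\<^sub>\<lambda> Lag]\<^sup>+\<^sub>\<lambda>\<close>. Absolute continuity is meant, as usual, on every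
  compact subinterval of the half-line.\<close>

definition saddle_flow_solution ::
    "real^'v^'v \<Rightarrow> (real^'v \<Rightarrow> real^'k \<Rightarrow> real) \<Rightarrow> (real \<Rightarrow> real^'v) \<Rightarrow> (real \<Rightarrow> real^'k) \<Rightarrow> bool" where
  "saddle_flow_solution A Lag z lam \<longleftrightarrow>
     (\<forall>T\<ge>0. abs_continuous_on {0..T} z \<and> abs_continuous_on {0..T} lam) \<and>
     (AE t in lebesgue. 0 \<le> t \<longrightarrow>
        (z has_vector_derivative - (A *v grad (\<lambda>y. Lag y (lam t)) (z t))) (at t within {0..}) \<and>
        (lam has_vector_derivative pos_proj (grad (\<lambda>l. Lag (z t) l) (lam t)) (lam t))
          (at t within {0..}))"

end

theory Submission
  imports Defs
begin

text \<open>For a saddle point \<open>(z\<^sup>*, \<lambda>\<^sup>*)\<close> the function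
  \<open>V = (z - z\<^sup>*) \<bullet> A\<inverse> (z - z\<^sup>*) / 2 + \<parallel>\<lambda> - \<lambda>\<^sup>*\<parallel>\<^sup>2 / 2\<close> satisfies, almost everywhere,
  \<open>V' \<le> - (z - z\<^sup>*) \<bullet> L H L (z - z\<^sup>*) + \<lambda> \<bullet> P(z\<^sup>*)\<close>, where both summands are nonpositive; the
  bound on \<open>M\<close> makes \<open>A\<close> positive definite. Barbalat's lemma (which
  replaces LaSalle's principle, not available for a discontinuous right-hand side) yields
  \<open>z \<rightarrow> z\<^sup>*\<close>, since \<open>\<one> \<bullet> z\<close> is conserved, and \<open>\<lambda> \<bullet> P(z\<^sup>*) \<rightarrow> 0\<close>. Applied once more, to
  the components of the now convergent \<open>z\<close>, it gives \<open>\<nabla>\<^sub>z Lag \<rightarrow> 0\<close>. So every limit point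
  of \<open>\<lambda>\<close> is again a multiplier, and \<open>V\<close> centred at one of them tends to \<open>0\<close>.\<close>

section \<open>Absolutely continuous functions\<close>

text \<open>Measuring z in the metric of the inverse of \<open>A\<close> removes the preconditioner:
  the primal part of the derivative of V pairs z - z* with the plain gradient, so its coupling with
  \<lambda> cancels against the dual part as in the case \<open>A = mat 1\<close>. Positivity of
  \<open>A\<close> follows once I + S is positive definite for S = I - L H L, that is, once L H L <
  2 I. The lower Loewner bound gives this on the complement of the all-ones vector, and L H L
  vanishes on that vector. Two degeneracies shape the rest. The Hessian is singular along the
  all-ones vector, so the decay of V controls z only modulo that direction. Multipliers need not be
  unique, so V centred at a fixed one need not tend to 0. Moreover, derivatives exist only almost
  everywhere, so every use of their sign rests on absolute continuity.\<close>

lemma division_of_real_elem: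
  fixes S T :: "real set"
  assumes "D division_of T" "T \<subseteq> S" "K \<in> D"
  shows "Sup K \<in> S" "Inf K \<in> S" "Inf K \<le> Sup K"
proof -
  obtain u v where K: "K = {u..v}" "K \<noteq> {}" "K \<subseteq> T"
    using division_ofD(2,3,4)[OF assms(1)] assms(3) by (metis box_real(2))
  then have "u \<le> v" by simp
  then have "u \<in> K" "v \<in> K" "Sup K = v" "Inf K = u" using K(1) by auto
  then show "Sup K \<in> S" "Inf K \<in> S" "Inf K \<le> Sup K" using K \<open>u \<le> v\<close> assms(2) by auto
qed

text \<open>The common pattern behind sums, linear images and products. The sign of \<open>c\<close>
  is left open so that operator bounds can be inserted as they come.\<close>

lemma abs_continuous_on_mono_dist:
  fixes f :: "real \<Rightarrow> 'b::real_normed_vector"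
  assumes S: "convex S" and f: "abs_continuous_on S f" and h: "abs_continuous_on S h"
    and le: "\<And>s t. s \<in> S \<Longrightarrow> t \<in> S \<Longrightarrow> norm (k s - k t) \<le> c * (norm (f s - f t) + norm (h s - h t))"
  shows "abs_continuous_on S k"
  unfolding abs_continuous_on_def
proof (intro allI impI)
  fix e :: real assume "e > 0"
  define C where "C = \<bar>c\<bar> + 1"
  have "C > 0" by (simp add: C_def)
  define e' where "e' = e / C / 2"
  have "e' > 0" using \<open>e > 0\<close> \<open>C > 0\<close> by (simp add: e'_def)
  obtain d1 where "d1 > 0" and d1: "\<And>D T. D division_of T \<Longrightarrow> T \<subseteq> S \<Longrightarrow> (\<Sum>K\<in>D. Sup K - Inf K) < d1 \<Longrightarrow>
        (\<Sum>K\<in>D. norm (f (Sup K) - f (Inf K))) < e'"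
    using f \<open>e' > 0\<close> unfolding abs_continuous_on_def by metis
  obtain d2 where "d2 > 0" and d2: "\<And>D T. D division_of T \<Longrightarrow> T \<subseteq> S \<Longrightarrow> (\<Sum>K\<in>D. Sup K - Inf K) < d2 \<Longrightarrow>
        (\<Sum>K\<in>D. norm (h (Sup K) - h (Inf K))) < e'"
    using h \<open>e' > 0\<close> unfolding abs_continuous_on_def by metis
  show "\<exists>d>0. \<forall>D T. D division_of T \<and> T \<subseteq> S \<and> (\<Sum>K\<in>D. Sup K - Inf K) < d \<longrightarrow>
        (\<Sum>K\<in>D. norm (k (Sup K) - k (Inf K))) < e"
  proof (intro exI[of _ "min d1 d2"] conjI allI impI)
    show "min d1 d2 > 0" using \<open>d1 > 0\<close> \<open>d2 > 0\<close> by simp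
    fix D T assume D: "D division_of T \<and> T \<subseteq> S \<and> (\<Sum>K\<in>D. Sup K - Inf K) < min d1 d2"
    have "(\<Sum>K\<in>D. norm (k (Sup K) - k (Inf K)))
        \<le> (\<Sum>K\<in>D. \<bar>c\<bar> * (norm (f (Sup K) - f (Inf K)) + norm (h (Sup K) - h (Inf K))))"
    proof (rule sum_mono)
      fix K assume "K \<in> D"
      then have "Sup K \<in> S" "Inf K \<in> S"
        using D division_of_real_elem[of D T S K] by simp_all
      from le[OF this] show "norm (k (Sup K) - k (Inf K))
          \<le> \<bar>c\<bar> * (norm (f (Sup K) - f (Inf K)) + norm (h (Sup K) - h (Inf K)))"
        by (smt (verit) mult_right_mono norm_ge_zero)
    qed
    also have "\<dots> = \<bar>c\<bar> * ((\<Sum>K\<in>D. norm (f (Sup K) - f (Inf K))) + (\<Sum>K\<in>D. norm (h (Sup K) - h (Inf K))))"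
      by (simp add: sum_distrib_left sum.distrib distrib_left)
    also have "\<dots> \<le> \<bar>c\<bar> * (e' + e')"
      using d1[of D T] d2[of D T] D by (intro mult_left_mono) auto
    also have "\<dots> < e"
    proof -
      have "C * (2 * e') = e" using \<open>C > 0\<close> by (simp add: e'_def)
      then show ?thesis using \<open>e' > 0\<close> by (simp add: C_def algebra_simps)
    qed
    finally show "(\<Sum>K\<in>D. norm (k (Sup K) - k (Inf K))) < e" .
  qed
qed

lemma lipschitz_abs_continuous_on:
  fixes k :: "real \<Rightarrow> 'b::real_normed_vector"
  assumes "\<And>s t. s \<in> S \<Longrightarrow> t \<in> S \<Longrightarrow> norm (k s - k t) \<le> c * \<bar>s - t\<bar>"
  shows "abs_continuous_on S k"
  unfolding abs_continuous_on_def
proof (intro allI impI)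
  fix e :: real assume "e > 0"
  show "\<exists>d>0. \<forall>D T. D division_of T \<and> T \<subseteq> S \<and> (\<Sum>K\<in>D. Sup K - Inf K) < d \<longrightarrow>
        (\<Sum>K\<in>D. norm (k (Sup K) - k (Inf K))) < e"
  proof (intro exI[of _ "e / (\<bar>c\<bar> + 1)"] conjI allI impI)
    show "e / (\<bar>c\<bar> + 1) > 0" using \<open>e > 0\<close> by simp
    fix D T assume D: "D division_of T \<and> T \<subseteq> S \<and> (\<Sum>K\<in>D. Sup K - Inf K) < e / (\<bar>c\<bar> + 1)"
    have len: "norm (k (Sup K) - k (Inf K)) \<le> (\<bar>c\<bar> + 1) * (Sup K - Inf K)" if "K \<in> D" for K
    proof -
      have "Sup K \<in> S" "Inf K \<in> S" "Inf K \<le> Sup K"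
        using D that division_of_real_elem[of D T S K] by simp_all
      with assms[of "Sup K" "Inf K"] show ?thesis
        by (smt (verit) mult_right_mono)
    qed
    then have "(\<Sum>K\<in>D. norm (k (Sup K) - k (Inf K))) \<le> (\<bar>c\<bar> + 1) * (\<Sum>K\<in>D. Sup K - Inf K)"
      unfolding sum_distrib_left by (rule sum_mono)
    also have "\<dots> < e" using D by (simp add: field_simps)
    finally show "(\<Sum>K\<in>D. norm (k (Sup K) - k (Inf K))) < e" .
  qed
qed

text \<open>A division with the single interval between the two points is already the epsilon-delta
  test; convexity keeps that interval inside \<open>S\<close>.\<close>

lemma abs_continuous_on_imp_continuous_on:
  assumes f: "abs_continuous_on S f" and S: "convex S"
  shows "continuous_on S f"
  unfolding continuous_on_iff
proof (intro ballI allI impI)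
  fix x :: real and e :: real assume x: "x \<in> S" "e > 0"
  obtain d where "d > 0" and d: "\<And>D T. D division_of T \<Longrightarrow> T \<subseteq> S \<Longrightarrow> (\<Sum>K\<in>D. Sup K - Inf K) < d \<Longrightarrow>
        (\<Sum>K\<in>D. norm (f (Sup K) - f (Inf K))) < e"
    using f \<open>e > 0\<close> unfolding abs_continuous_on_def by metis
  show "\<exists>d>0. \<forall>x'\<in>S. dist x' x < d \<longrightarrow> dist (f x') (f x) < e"
  proof (intro exI[of _ d] conjI ballI impI)
    fix y assume y: "y \<in> S" "dist y x < d"
    define u v where "u = min x y" and "v = max x y"
    have "u \<le> v" "v - u < d" using y by (auto simp: u_def v_def dist_real_def)
    have "u \<in> S" "v \<in> S" using x y by (auto simp: u_def v_def min_def max_def)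
    then have "cbox u v \<subseteq> S" using S
      by (metis closed_segment_subset closed_segment_eq_real_ivl1 \<open>u \<le> v\<close> box_real(2))
    then have "norm (f v - f u) < e"
      using d[of "{cbox u v}" "cbox u v"] division_of_self[of u v] \<open>u \<le> v\<close> \<open>v - u < d\<close> by simp
    then show "dist (f y) (f x) < e"
      by (auto simp: u_def v_def dist_norm min_def max_def norm_minus_commute split: if_splits)
  qed (rule \<open>d > 0\<close>)
qed

lemma abs_continuous_on_const: "abs_continuous_on S (\<lambda>t. c)"
  by (rule lipschitz_abs_continuous_on[where c = 0]) simp

lemma abs_continuous_on_ident: "abs_continuous_on S (\<lambda>t::real. t)"
  by (rule lipschitz_abs_continuous_on[where c = 1]) simp

lemma abs_continuous_on_add:
  assumes "convex S" "abs_continuous_on S f" "abs_continuous_on S h"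
  shows "abs_continuous_on S (\<lambda>t. f t + h t)"
  by (rule abs_continuous_on_mono_dist[where c = 1, OF assms])
     (use norm_triangle_ineq in \<open>simp add: add_diff_add\<close>)

lemma abs_continuous_on_linear:
  assumes "convex S" "abs_continuous_on S f" "bounded_linear T"
  shows "abs_continuous_on S (\<lambda>t. T (f t))"
proof -
  interpret bounded_linear T by fact
  obtain K where K: "\<And>x. norm (T x) \<le> norm x * K" using bounded by blast
  show ?thesis
  proof (rule abs_continuous_on_mono_dist[where c = K, OF assms(1,2,2)])
    fix s t
    have "norm (f s - f t) * K \<ge> 0" using K[of "f s - f t"] by (smt (verit) norm_ge_zero)
    then show "norm (T (f s) - T (f t)) \<le> K * (norm (f s - f t) + norm (f s - f t))"
      using K[of "f s - f t"] by (simp add: diff algebra_simps)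
  qed
qed

text \<open>Compactness bounds both factors, after which the product rule for increments applies. On
  the half-line the identity is absolutely continuous and its square is not, hence the local notion
  used later.\<close>

lemma abs_continuous_on_inner:
  fixes f h :: "real \<Rightarrow> 'b::real_inner"
  assumes S: "convex S" "compact S" and f: "abs_continuous_on S f" and h: "abs_continuous_on S h"
  shows "abs_continuous_on S (\<lambda>t. f t \<bullet> h t)"
proof -
  have "bounded (f ` S)" "bounded (h ` S)"
    using abs_continuous_on_imp_continuous_on[OF f S(1)] abs_continuous_on_imp_continuous_on[OF h S(1)] S(2)
    by (auto intro!: compact_imp_bounded compact_continuous_image)
  then obtain c1 c2 where c1: "\<And>t. t \<in> S \<Longrightarrow> norm (f t) \<le> c1" and c2: "\<And>t. t \<in> S \<Longrightarrow> norm (h t) \<le> c2"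
    by (force simp: bounded_iff)
  show ?thesis
  proof (rule abs_continuous_on_mono_dist[where c = "max c1 c2", OF S(1) f h])
    fix s t assume st: "s \<in> S" "t \<in> S"
    have "norm (f s \<bullet> h s - f t \<bullet> h t) = norm ((f s - f t) \<bullet> h s + f t \<bullet> (h s - h t))"
      by (simp add: algebra_simps)
    also have "\<dots> \<le> norm (f s - f t) * norm (h s) + norm (f t) * norm (h s - h t)"
      by (smt (verit) Cauchy_Schwarz_ineq2 real_norm_def)
    also have "\<dots> \<le> norm (f s - f t) * max c1 c2 + max c1 c2 * norm (h s - h t)"
      using c1[OF st(2)] c2[OF st(1)] by (intro add_mono mult_left_mono mult_right_mono) auto
    finally show "norm (f s \<bullet> h s - f t \<bullet> h t) \<le> max c1 c2 * (norm (f s - f t) + norm (h s - h t))"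
      by (simp add: algebra_simps)
  qed
qed

section \<open>Monotonicity from the sign of an almost everywhere derivative\<close>

text \<open>The straddle form of differentiability: both endpoints may move as long as they enclose
  \<open>t\<close>. Splitting the increment at \<open>t\<close> makes the two errors add up to
  \<open>e\<close> times the length.\<close>

lemma straddle_nonneg_derivative:
  fixes f :: "real \<Rightarrow> real"
  assumes der: "(f has_vector_derivative D) (at t within S)" and "0 \<le> D" "0 < e"
  obtains d where "0 < d"
    "\<And>u v. u \<in> S \<Longrightarrow> v \<in> S \<Longrightarrow> u \<le> t \<Longrightarrow> t \<le> v \<Longrightarrow> {u..v} \<subseteq> ball t d \<Longrightarrow> - e * (v - u) \<le> f v - f u"
proof -
  obtain d where "0 < d" and d: "\<And>y. y \<in> S \<Longrightarrow> norm (y - t) < d \<Longrightarrow>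
      norm (f y - f t - (y - t) *\<^sub>R D) \<le> e * norm (y - t)"
    using der \<open>0 < e\<close> unfolding has_vector_derivative_def has_derivative_within_alt by blast
  show thesis
  proof (rule that[OF \<open>0 < d\<close>])
    fix u v assume uv: "u \<in> S" "v \<in> S" "u \<le> t" "t \<le> v" "{u..v} \<subseteq> ball t d"
    then have "u \<in> ball t d" "v \<in> ball t d" by (meson atLeastAtMost_iff order_refl order_trans subsetD)+
    then have "\<bar>f u - f t - (u - t) * D\<bar> \<le> e * (t - u)" "\<bar>f v - f t - (v - t) * D\<bar> \<le> e * (v - t)"
      using d[of u] d[of v] uv by (auto simp: dist_real_def abs_minus_commute)
    moreover have "(u - t) * D \<le> 0" "(v - t) * D \<ge> 0"
      using uv \<open>0 \<le> D\<close> by (auto simp: mult_nonpos_nonneg)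
    ultimately show "- e * (v - u) \<le> f v - f u" by (simp add: algebra_simps)
  qed
qed

text \<open>Cousin's lemma gives a tagged division whose intervals tagged outside the exceptional set
  contribute at least \<open>- e (b - a)\<close> by differentiability, while those tagged inside it have small
  total length, hence contribute little by absolute continuity.\<close>

lemma abs_continuous_AE_nonneg_derivative_imp_le:
  fixes f :: "real \<Rightarrow> real"
  assumes ab: "a \<le> b" and ac: "abs_continuous_on {a..b} f"
    and der: "AE t in lebesgue. t \<in> {a..b} \<longrightarrow>
      (\<exists>D\<ge>0. (f has_vector_derivative D) (at t within {a..b}))"
  shows "f a \<le> f b"
proof -
  obtain N where N: "N \<in> null_sets lebesgue"
    and N': "{t \<in> space lebesgue. \<not> (t \<in> {a..b} \<longrightarrow>
      (\<exists>D\<ge>0. (f has_vector_derivative D) (at t within {a..b})))} \<subseteq> N"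
    using der unfolding eventually_ae_filter by blast
  have derN: "\<exists>D\<ge>0. (f has_vector_derivative D) (at t within {a..b})" if "t \<in> {a..b}" "t \<notin> N" for t
    using N' that by (simp add: subset_iff) blast
  have N: "negligible N" using N by (simp add: negligible_iff_null_sets)
  have bound: "f a - f b \<le> e * (b - a) + e" if "e > 0" for e
  proof -
    obtain d where "d > 0" and d: "\<And>D T. D division_of T \<Longrightarrow> T \<subseteq> {a..b} \<Longrightarrow>
        (\<Sum>K\<in>D. Sup K - Inf K) < d \<Longrightarrow> (\<Sum>K\<in>D. norm (f (Sup K) - f (Inf K))) < e"
      using ac \<open>e > 0\<close> unfolding abs_continuous_on_def by metis
    \<comment> \<open>The measure of this neighbourhood lies below the absolute continuity threshold
      \<open>d\<close>. Fine intervals tagged in \<open>N\<close> will be confined to it, which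
      bounds their total length.\<close>
    obtain G where G: "open G" "N \<subseteq> G" "G \<in> lmeasurable" "measure lebesgue G < d"
    proof -
      have "N \<in> sets lebesgue" using N negligible_imp_sets by blast
      then obtain G where G: "open G" "N \<subseteq> G" "G - N \<in> lmeasurable" "emeasure lebesgue (G - N) < ennreal d"
        using sets_lebesgue_outer_open \<open>d > 0\<close> by blast
      have "G \<in> lmeasurable"
        using G N by (metis Un_Diff_cancel2 Un_absorb2 fmeasurable.Un negligible_imp_measurable)
      moreover have "measure lebesgue G = measure lebesgue (G - N)"
        using N \<open>G \<in> lmeasurable\<close> by (metis fmeasurableD measure_Diff_null_set negligible_iff_null_sets)
      moreover have "measure lebesgue (G - N) < d"
        using G(3,4) \<open>d > 0\<close> by (simp add: emeasure_eq_measure2 ennreal_less_iff)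
      ultimately show thesis using that G by metis
    qed
    have "\<exists>r>0. \<forall>u\<in>{a..b}. \<forall>v\<in>{a..b}. u \<le> t \<longrightarrow> t \<le> v \<longrightarrow> {u..v} \<subseteq> ball t r \<longrightarrow>
        (t \<in> N \<longrightarrow> {u..v} \<subseteq> G) \<and> (t \<notin> N \<longrightarrow> - e * (v - u) \<le> f v - f u)" if "t \<in> {a..b}" for t
    proof (cases "t \<in> N")
      case True
      then obtain r where "r > 0" "ball t r \<subseteq> G" using G(1,2) open_contains_ball by blast
      then show ?thesis using True by (meson subset_trans)
    next
      case False
      then obtain D where "D \<ge> 0" and D: "(f has_vector_derivative D) (at t within {a..b})"
        using derN[OF \<open>t \<in> {a..b}\<close>] by blast
      then obtain r where "r > 0" "\<And>u v. u \<in> {a..b} \<Longrightarrow> v \<in> {a..b} \<Longrightarrow> u \<le> t \<Longrightarrow> t \<le> v \<Longrightarrow>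
          {u..v} \<subseteq> ball t r \<Longrightarrow> - e * (v - u) \<le> f v - f u"
        using straddle_nonneg_derivative[OF D \<open>D \<ge> 0\<close> \<open>e > 0\<close>] by metis
      then show ?thesis using False by meson
    qed
    then obtain r where r: "\<And>t. t \<in> {a..b} \<Longrightarrow> r t > 0"
      "\<And>t u v. t \<in> {a..b} \<Longrightarrow> u \<in> {a..b} \<Longrightarrow> v \<in> {a..b} \<Longrightarrow> u \<le> t \<Longrightarrow> t \<le> v \<Longrightarrow> {u..v} \<subseteq> ball t (r t) \<Longrightarrow>
        (t \<in> N \<longrightarrow> {u..v} \<subseteq> G) \<and> (t \<notin> N \<longrightarrow> - e * (v - u) \<le> f v - f u)"
      by metis
    define \<gamma> where "\<gamma> t = ball t (if t \<in> {a..b} then r t else 1)" for t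
    have "gauge \<gamma>" using r(1) by (auto simp: gauge_def \<gamma>_def)
    then obtain p where p: "p tagged_division_of {a..b}" "\<gamma> fine p"
      using fine_division_exists_real by blast
    have elem: "\<exists>u v. K = {u..v} \<and> u \<le> v \<and> u \<in> {a..b} \<and> v \<in> {a..b} \<and>
        (t \<in> N \<longrightarrow> {u..v} \<subseteq> G) \<and> (t \<notin> N \<longrightarrow> - e * (v - u) \<le> f v - f u)" if tK: "(t, K) \<in> p" for t K
    proof -
      have "t \<in> K" "K \<subseteq> {a..b}"
        using tagged_division_ofD(2,3)[OF p(1) tK] by simp_all
      obtain u v where K: "K = {u..v}"
        using tagged_division_ofD(4)[OF p(1) tK] by (metis box_real(2))
      have "t \<in> {a..b}" using \<open>t \<in> K\<close> \<open>K \<subseteq> {a..b}\<close> by blast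
      then have "\<gamma> t = ball t (r t)" by (simp add: \<gamma>_def)
      then have "K \<subseteq> ball t (r t)" using fineD[OF p(2) tK] by simp
      moreover have "u \<le> t" "t \<le> v" "u \<in> {a..b}" "v \<in> {a..b}" "t \<in> {a..b}"
        using K \<open>t \<in> K\<close> \<open>K \<subseteq> {a..b}\<close> by (auto simp: subset_iff)
      ultimately show ?thesis using r(2)[of t u v] K by (intro exI[of _ u] exI[of _ v]) auto
    qed
    define \<Delta> where "\<Delta> K = f (Sup K) - f (Inf K)" for K :: "real set"
    define p1 where "p1 = {(t, K) \<in> p. t \<in> N}"
    define p2 where "p2 = {(t, K) \<in> p. t \<notin> N}"
    have fin: "finite p" using p(1) by auto
    have pu: "p = p1 \<union> p2" "p1 \<inter> p2 = {}" "p1 \<subseteq> p" "p2 \<subseteq> p"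
      by (auto simp: p1_def p2_def)
    have "(\<Sum>(t, K)\<in>p. \<Delta> K) = f b - f a"
      unfolding \<Delta>_def using additive_tagged_division_1[OF ab p(1)] .
    then have split: "f b - f a = (\<Sum>(t, K)\<in>p1. \<Delta> K) + (\<Sum>(t, K)\<in>p2. \<Delta> K)"
      using pu fin by (metis (no_types, lifting) finite_subset sum.union_disjoint)
    have "- e * (b - a) \<le> (\<Sum>(t, K)\<in>p2. - e * (Sup K - Inf K))"
    proof -
      have "(\<Sum>(t, K)\<in>p2. Sup K - Inf K) \<le> (\<Sum>(t, K)\<in>p. Sup K - Inf K)"
        by (rule sum_mono2[OF fin pu(4)]) (use elem in fastforce)
      also have "\<dots> = b - a"
        using additive_tagged_division_1[OF ab p(1), of "\<lambda>x. x"] .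
      finally have "e * (\<Sum>(t, K)\<in>p2. Sup K - Inf K) \<le> e * (b - a)" using \<open>e > 0\<close> by simp
      then show ?thesis by (simp add: sum_negf sum_distrib_left case_prod_unfold)
    qed
    also have "\<dots> \<le> (\<Sum>(t, K)\<in>p2. \<Delta> K)"
      by (rule sum_mono) (use elem in \<open>fastforce simp: \<Delta>_def p2_def\<close>)
    finally have 2: "- e * (b - a) \<le> (\<Sum>(t, K)\<in>p2. \<Delta> K)" .
    define D where "D = snd ` p1"
    have p1: "p1 tagged_division_of \<Union> D"
    proof -
      have "p1 tagged_partial_division_of {a..b}"
        using p(1) pu(3) tagged_partial_division_subset tagged_division_of_def by blast
      then show ?thesis unfolding D_def by (rule tagged_partial_division_of_Union_self)
    qed
    have D: "D division_of \<Union> D" unfolding D_def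
      using division_of_tagged_division[OF p1] by (simp add: D_def)
    have DK: "\<exists>u v. K = {u..v} \<and> u \<le> v \<and> u \<in> {a..b} \<and> v \<in> {a..b} \<and> K \<subseteq> G" if "K \<in> D" for K
      using that elem unfolding D_def p1_def by fastforce
    have "(\<Sum>K\<in>D. Sup K - Inf K) = (\<Sum>K\<in>D. measure lebesgue K)"
      by (rule sum.cong) (use DK in fastforce)+
    also have "\<dots> = measure lebesgue (\<Union> D)" by (rule content_division[OF D])
    also have "\<dots> \<le> measure lebesgue G"
      using DK G(3) D by (intro measure_mono_fmeasurable) (auto intro: fmeasurableD lmeasurable_division)
    finally have "(\<Sum>K\<in>D. norm (f (Sup K) - f (Inf K))) < e"
      using G(4) DK by (intro d[OF D]) fastforce+
    moreover have "\<bar>\<Sum>(t, K)\<in>p1. \<Delta> K\<bar> \<le> (\<Sum>K\<in>D. norm (f (Sup K) - f (Inf K)))"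
    proof -
      \<comment> \<open>One interval can carry two tags only if its interior is empty, so passing
        from pairs to intervals needs a function vanishing on all such intervals. That includes the
        empty one, where \<open>Sup\<close> and \<open>Inf\<close> say nothing; on \<open>D\<close>
        the two functions agree.\<close>
      define \<Theta> where "\<Theta> K = (if interior K = {} then 0 else \<bar>\<Delta> K\<bar>)" for K
      have \<Theta>: "\<bar>\<Delta> K\<bar> = \<Theta> K" if "K \<in> D" for K
        using DK[OF that] by (auto simp: \<Theta>_def \<Delta>_def)
      have "\<bar>\<Sum>(t, K)\<in>p1. \<Delta> K\<bar> \<le> (\<Sum>(t, K)\<in>p1. \<bar>\<Delta> K\<bar>)"
        by (simp add: case_prod_unfold sum_abs)
      also have "\<dots> = (\<Sum>(t, K)\<in>p1. \<Theta> K)"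
        by (rule sum.cong) (use \<Theta> in \<open>force simp: D_def\<close>)+
      also have "\<dots> = (\<Sum>K\<in>snd ` p1. \<Theta> K)"
        by (rule sum.over_tagged_division_lemma[OF p1]) (simp add: \<Theta>_def)
      also have "\<dots> = (\<Sum>K\<in>D. \<bar>\<Delta> K\<bar>)" using \<Theta> by (simp add: D_def)
      finally show ?thesis by (simp add: \<Delta>_def)
    qed
    ultimately show "f a - f b \<le> e * (b - a) + e" using split 2 by (simp add: algebra_simps)
  qed
  show "f a \<le> f b"
  proof (rule field_le_epsilon)
    fix e :: real assume "e > 0"
    define C where "C = b - a + 1"
    have "C > 0" using ab by (simp add: C_def)
    then have "f a - f b \<le> e / C * (b - a) + e / C" using bound[of "e / C"] \<open>e > 0\<close> by simp
    also have "\<dots> = e / C * C" by (simp add: C_def distrib_left flip: times_divide_eq_left)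
    also have "\<dots> = e" using \<open>C > 0\<close> by simp
    finally show "f a \<le> f b + e" by simp
  qed
qed

section \<open>Local absolute continuity on the half-line and Barbalat's lemma\<close>

definition loc_abs_continuous :: "(real \<Rightarrow> 'b::real_normed_vector) \<Rightarrow> bool" where
  "loc_abs_continuous f \<longleftrightarrow> (\<forall>T\<ge>0. abs_continuous_on {0..T} f)"

lemma abs_continuous_on_subset:
  "abs_continuous_on S f \<Longrightarrow> T \<subseteq> S \<Longrightarrow> abs_continuous_on T f"
  unfolding abs_continuous_on_def by (meson order_trans)

lemma loc_abs_continuous_Icc:
  "loc_abs_continuous f \<Longrightarrow> 0 \<le> a \<Longrightarrow> abs_continuous_on {a..b} f"
  unfolding loc_abs_continuous_def
  by (meson abs_continuous_on_subset atLeastatMost_subset_iff max.cobounded1 max.cobounded2)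

lemma loc_abs_continuous_const: "loc_abs_continuous (\<lambda>t. c)"
  by (simp add: loc_abs_continuous_def abs_continuous_on_const)

lemma loc_abs_continuous_ident: "loc_abs_continuous (\<lambda>t. t)"
  by (simp add: loc_abs_continuous_def abs_continuous_on_ident)

lemma loc_abs_continuous_add:
  "loc_abs_continuous f \<Longrightarrow> loc_abs_continuous h \<Longrightarrow> loc_abs_continuous (\<lambda>t. f t + h t)"
  by (simp add: loc_abs_continuous_def abs_continuous_on_add)

lemma loc_abs_continuous_linear:
  "bounded_linear T \<Longrightarrow> loc_abs_continuous f \<Longrightarrow> loc_abs_continuous (\<lambda>t. T (f t))"
  by (simp add: loc_abs_continuous_def abs_continuous_on_linear)

lemma loc_abs_continuous_scaleR:
  "loc_abs_continuous f \<Longrightarrow> loc_abs_continuous (\<lambda>t. (c::real) *\<^sub>R f t)"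
  by (rule loc_abs_continuous_linear[OF bounded_linear_scaleR_right])

lemma loc_abs_continuous_minus:
  "loc_abs_continuous f \<Longrightarrow> loc_abs_continuous (\<lambda>t. - f t)"
  using loc_abs_continuous_scaleR[of f "-1"] by simp

lemma loc_abs_continuous_diff:
  "loc_abs_continuous f \<Longrightarrow> loc_abs_continuous h \<Longrightarrow> loc_abs_continuous (\<lambda>t. f t - h t)"
  using loc_abs_continuous_add[of f "\<lambda>t. - h t"] loc_abs_continuous_minus[of h] by simp

lemma loc_abs_continuous_inner:
  fixes f h :: "real \<Rightarrow> 'b::real_inner"
  shows "loc_abs_continuous f \<Longrightarrow> loc_abs_continuous h \<Longrightarrow> loc_abs_continuous (\<lambda>t. f t \<bullet> h t)"
  by (simp add: loc_abs_continuous_def abs_continuous_on_inner)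

lemma loc_abs_continuous_imp_continuous_on:
  "loc_abs_continuous f \<Longrightarrow> 0 \<le> a \<Longrightarrow> continuous_on {a..b} f"
  by (simp add: loc_abs_continuous_Icc abs_continuous_on_imp_continuous_on)

lemma loc_abs_continuous_AE_nonneg_imp_le:
  fixes f :: "real \<Rightarrow> real"
  assumes "0 \<le> a" "a \<le> b" "loc_abs_continuous f"
    and der: "AE t in lebesgue. a \<le> t \<and> t \<le> b \<longrightarrow>
      (\<exists>D\<ge>0. (f has_vector_derivative D) (at t within {0..}))"
  shows "f a \<le> f b"
proof (rule abs_continuous_AE_nonneg_derivative_imp_le[of a b f])
  show "AE t in lebesgue. t \<in> {a..b} \<longrightarrow>
      (\<exists>D\<ge>0. (f has_vector_derivative D) (at t within {a..b}))"
    using der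
  proof eventually_elim
    case (elim t)
    have "{a..b} \<subseteq> {0..}" using \<open>0 \<le> a\<close> by auto
    then show ?case using elim by (meson atLeastAtMost_iff has_vector_derivative_within_subset)
  qed
qed (use assms loc_abs_continuous_Icc in auto)

text \<open>One-sided mean value inequality, from monotonicity of
  \<open>c * t - f t\<close>.\<close>

lemma loc_abs_continuous_AE_derivative_le:
  fixes f :: "real \<Rightarrow> real"
  assumes "0 \<le> a" "a \<le> b" "loc_abs_continuous f"
    and der: "AE t in lebesgue. a \<le> t \<and> t \<le> b \<longrightarrow>
      (\<exists>D\<le>c. (f has_vector_derivative D) (at t within {0..}))"
  shows "f b - f a \<le> c * (b - a)"
proof -
  have "c * a - f a \<le> c * b - f b"
  proof (rule loc_abs_continuous_AE_nonneg_imp_le[OF assms(1,2)])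
    show "loc_abs_continuous (\<lambda>t. c * t - f t)"
      using loc_abs_continuous_scaleR[OF loc_abs_continuous_ident, of c]
      by (intro loc_abs_continuous_diff assms) simp
    show "AE t in lebesgue. a \<le> t \<and> t \<le> b \<longrightarrow>
      (\<exists>D\<ge>0. ((\<lambda>t. c * t - f t) has_vector_derivative D) (at t within {0..}))"
      using der
    proof eventually_elim
      case (elim t)
      show ?case
      proof
        assume "a \<le> t \<and> t \<le> b"
        then obtain D where D: "D \<le> c" "(f has_vector_derivative D) (at t within {0..})"
          using elim by blast
        have "((\<lambda>t. c * t - f t) has_vector_derivative c - D) (at t within {0..})"
          by (auto intro!: derivative_eq_intros D)
        then show "\<exists>D\<ge>0. ((\<lambda>t. c * t - f t) has_vector_derivative D) (at t within {0..})"
          using D by (intro exI[of _ "c - D"]) auto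
      qed
    qed
  qed
  then show ?thesis by (simp add: algebra_simps)
qed

lemma loc_abs_continuous_nonincreasing_convergent:
  fixes f :: "real \<Rightarrow> real"
  assumes ac: "loc_abs_continuous f" and lb: "\<And>t. 0 \<le> t \<Longrightarrow> B \<le> f t"
    and der: "AE t in lebesgue. 0 \<le> t \<longrightarrow> (\<exists>D\<le>0. (f has_vector_derivative D) (at t within {0..}))"
  shows "\<exists>l. (f \<longlongrightarrow> l) at_top" "\<And>t. 0 \<le> t \<Longrightarrow> f t \<le> f 0"
proof -
  have anti: "f t \<le> f s" if "0 \<le> s" "s \<le> t" for s t
  proof -
    have "f t - f s \<le> 0 * (t - s)"
      by (rule loc_abs_continuous_AE_derivative_le[OF that ac]) (use der that in \<open>auto elim!: eventually_mono\<close>)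
    then show ?thesis by simp
  qed
  then show "\<And>t. 0 \<le> t \<Longrightarrow> f t \<le> f 0" by simp
  define l where "l = Inf (f ` {0..})"
  have bdd: "bdd_below (f ` {0..})" using lb by (intro bdd_belowI2[where m = B]) auto
  have "(f \<longlongrightarrow> l) at_top"
  proof (rule decreasing_tendsto)
    show "\<forall>\<^sub>F t in at_top. l \<le> f t"
      using eventually_ge_at_top[of 0]
      by eventually_elim (use bdd in \<open>auto simp: l_def intro: cInf_lower\<close>)
    fix x assume "l < x"
    then obtain s where s: "0 \<le> s" "f s < x"
      unfolding l_def using cInf_lessD[of "f ` {0..}" x] by auto
    show "\<forall>\<^sub>F t in at_top. f t < x"
      using eventually_ge_at_top[of s] by eventually_elim (use anti s in fastforce)
  qed
  then show "\<exists>l. (f \<longlongrightarrow> l) at_top" ..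
qed

text \<open>Barbalat's lemma. The one-sided bound needs neither integrals nor a sign of \<open>W\<close>, so that it can
  also be applied to \<open>W\<close> and \<open>- W\<close>.\<close>

lemma barbalat_eventually_less:
  fixes V W :: "real \<Rightarrow> real"
  assumes ac: "loc_abs_continuous V" and lim: "(V \<longlongrightarrow> l) at_top"
    and W: "uniformly_continuous_on {0..} W"
    and der: "AE t in lebesgue. 0 \<le> t \<longrightarrow> (\<exists>D\<le>- W t. (V has_vector_derivative D) (at t within {0..}))"
    and "e > 0"
  shows "\<forall>\<^sub>F t in at_top. W t < e"
proof -
  obtain d where "d > 0" and d: "\<And>s t. 0 \<le> s \<Longrightarrow> 0 \<le> t \<Longrightarrow> dist s t < d \<Longrightarrow> dist (W s) (W t) < e / 2"
    using W \<open>e > 0\<close> unfolding uniformly_continuous_on_def by (metis atLeast_iff half_gt_zero)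
  \<comment> \<open>If \<open>W t \<ge> e\<close>, then \<open>W\<close> stays at least
    \<open>e / 2\<close> for a time \<open>d / 2\<close>, during which \<open>V\<close> loses at
    least \<open>2 * \<eta>\<close>. Two values within \<open>\<eta>\<close> of the limit cannot
    differ by that much.\<close>
  define \<eta> where "\<eta> = e / 2 * (d / 2) / 2"
  have "\<eta> > 0" using \<open>e > 0\<close> \<open>d > 0\<close> by (simp add: \<eta>_def)
  then have "\<forall>\<^sub>F t in at_top. dist (V t) l < \<eta>" using lim by (simp add: tendstoD)
  then obtain T where T: "\<And>t. t \<ge> T \<Longrightarrow> dist (V t) l < \<eta>" by (auto simp: eventually_at_top_linorder)
  show ?thesis using eventually_ge_at_top[of "max 0 T"]
  proof eventually_elim
    case (elim t)
    show ?case
    proof (rule ccontr)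
      assume "\<not> W t < e"
      have "V (t + d / 2) - V t \<le> - (e / 2) * (t + d / 2 - t)"
      proof (rule loc_abs_continuous_AE_derivative_le[OF _ _ ac])
        show "AE s in lebesgue. t \<le> s \<and> s \<le> t + d / 2 \<longrightarrow>
            (\<exists>D\<le>- (e / 2). (V has_vector_derivative D) (at s within {0..}))"
          using der
        proof eventually_elim
          case s: (elim s)
          show ?case
          proof
            assume ts: "t \<le> s \<and> s \<le> t + d / 2"
            then have "dist (W s) (W t) < e / 2"
              using elim \<open>d > 0\<close> by (intro d) (auto simp: dist_real_def)
            then have "W s \<ge> e / 2" using \<open>\<not> W t < e\<close> by (auto simp: dist_real_def abs_if split: if_splits)
            moreover obtain D where "D \<le> - W s" "(V has_vector_derivative D) (at s within {0..})"
              using s ts elim by auto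
            ultimately show "\<exists>D\<le>- (e / 2). (V has_vector_derivative D) (at s within {0..})"
              by (intro exI[of _ D]) auto
          qed
        qed
      qed (use elim \<open>d > 0\<close> in auto)
      then have "V (t + d / 2) - V t \<le> - (2 * \<eta>)" by (simp add: \<eta>_def algebra_simps)
      moreover have "dist (V t) l < \<eta>" "dist (V (t + d / 2)) l < \<eta>" using T elim \<open>d > 0\<close> by auto
      ultimately show False by (simp add: dist_real_def abs_if split: if_splits)
    qed
  qed
qed

section \<open>Uniform continuity from bounded derivatives\<close>

lemma loc_abs_continuous_bounded_derivative_lipschitz:
  fixes f :: "real \<Rightarrow> real"
  assumes ac: "loc_abs_continuous f"
    and der: "AE t in lebesgue. 0 \<le> t \<longrightarrow> (\<exists>D. \<bar>D\<bar> \<le> c \<and> (f has_vector_derivative D) (at t within {0..}))"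
    and "0 \<le> s" "0 \<le> t"
  shows "\<bar>f s - f t\<bar> \<le> c * \<bar>s - t\<bar>"
proof -
  have le: "\<bar>f t - f s\<bar> \<le> c * (t - s)" if "0 \<le> s" "s \<le> t" for s t
  proof -
    have "f t - f s \<le> c * (t - s)"
    proof (rule loc_abs_continuous_AE_derivative_le[OF that ac])
      show "AE u in lebesgue. s \<le> u \<and> u \<le> t \<longrightarrow> (\<exists>D\<le>c. (f has_vector_derivative D) (at u within {0..}))"
        using der by eventually_elim (use that in \<open>force simp: abs_le_iff\<close>)
    qed
    moreover have "- f t - (- f s) \<le> c * (t - s)"
    proof (rule loc_abs_continuous_AE_derivative_le[OF that loc_abs_continuous_minus[OF ac]])
      show "AE u in lebesgue. s \<le> u \<and> u \<le> t \<longrightarrow>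
          (\<exists>D\<le>c. ((\<lambda>t. - f t) has_vector_derivative D) (at u within {0..}))"
        using der
      proof eventually_elim
        case (elim u)
        show ?case
        proof
          assume "s \<le> u \<and> u \<le> t"
          then have "0 \<le> u" using that by simp
          then obtain D where D: "\<bar>D\<bar> \<le> c" "(f has_vector_derivative D) (at u within {0..})"
            using elim by auto
          have "((\<lambda>t. - f t) has_vector_derivative - D) (at u within {0..})"
            using D(2) by (rule has_vector_derivative_minus)
          then show "\<exists>D\<le>c. ((\<lambda>t. - f t) has_vector_derivative D) (at u within {0..})"
            using D(1) by (intro exI[of _ "- D"]) auto
        qed
      qed
    qed
    ultimately show ?thesis by linarith
  qed
  show ?thesis
    using le[of s t] le[of t s] assms(3,4) by (cases "s \<le> t") (simp_all add: abs_minus_commute)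
qed

text \<open>A quadratic function such as \<open>dissipation\<close> need not be uniformly continuous
  on the whole space; it is so on the compact closure of a bounded image.\<close>

lemma uniformly_continuous_on_compose_bounded:
  fixes x :: "'a::metric_space \<Rightarrow> 'b::euclidean_space" and \<phi> :: "'b \<Rightarrow> 'c::metric_space"
  assumes "uniformly_continuous_on S x" "bounded (x ` S)" "continuous_on UNIV \<phi>"
  shows "uniformly_continuous_on S (\<lambda>t. \<phi> (x t))"
proof -
  have "compact (closure (x ` S))" using assms(2) by (simp add: compact_closure)
  then have "uniformly_continuous_on (closure (x ` S)) \<phi>"
    using assms(3) by (meson compact_uniformly_continuous continuous_on_subset top_greatest)
  then have "uniformly_continuous_on (x ` S) \<phi>"
    unfolding uniformly_continuous_on_def by (meson closure_subset subsetD)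
  then show ?thesis using assms(1) uniformly_continuous_on_compose by blast
qed

lemma bounded_derivative_imp_uniformly_continuous_on:
  fixes x :: "real \<Rightarrow> 'b::euclidean_space"
  assumes ac: "loc_abs_continuous x"
    and der: "AE t in lebesgue. 0 \<le> t \<longrightarrow> (\<exists>D. norm D \<le> c \<and> (x has_vector_derivative D) (at t within {0..}))"
  shows "uniformly_continuous_on {0..} x"
proof -
  have comp: "\<bar>x s \<bullet> b - x t \<bullet> b\<bar> \<le> c * \<bar>s - t\<bar>" if "0 \<le> s" "0 \<le> t" "b \<in> Basis" for s t b
  proof (rule loc_abs_continuous_bounded_derivative_lipschitz[OF _ _ that(1,2)])
    show "loc_abs_continuous (\<lambda>t. x t \<bullet> b)"
      by (rule loc_abs_continuous_linear[OF bounded_linear_inner_left[of b] ac])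
    show "AE t in lebesgue. 0 \<le> t \<longrightarrow>
        (\<exists>D. \<bar>D\<bar> \<le> c \<and> ((\<lambda>t. x t \<bullet> b) has_vector_derivative D) (at t within {0..}))"
      using der
    proof eventually_elim
      case (elim t)
      show ?case
      proof
        assume "0 \<le> t"
        then obtain D where D: "norm D \<le> c" "(x has_vector_derivative D) (at t within {0..})"
          using elim by auto
        then show "\<exists>D. \<bar>D\<bar> \<le> c \<and> ((\<lambda>t. x t \<bullet> b) has_vector_derivative D) (at t within {0..})"
          using bounded_linear.has_vector_derivative[OF bounded_linear_inner_left[of b] D(2)]
            Basis_le_norm[OF that(3), of D] by (intro exI[of _ "D \<bullet> b"]) auto
      qed
    qed
  qed
  have lip: "norm (x s - x t) \<le> (of_nat DIM('b) * c) * \<bar>s - t\<bar>" if "0 \<le> s" "0 \<le> t" for s t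
  proof -
    have "norm (x s - x t) \<le> (\<Sum>b\<in>Basis. \<bar>(x s - x t) \<bullet> b\<bar>)" by (rule norm_le_l1)
    also have "\<dots> \<le> (\<Sum>b\<in>(Basis :: 'b set). c * \<bar>s - t\<bar>)"
      by (rule sum_mono) (use comp that in \<open>simp add: inner_diff_left\<close>)
    finally show ?thesis by simp
  qed
  show ?thesis unfolding uniformly_continuous_on_def
  proof (intro allI impI)
    fix e :: real assume "e > 0"
    define C where "C = \<bar>of_nat DIM('b) * c\<bar> + 1"
    have "C > 0" by (simp add: C_def)
    show "\<exists>d>0. \<forall>s\<in>{0..}. \<forall>t\<in>{0..}. dist t s < d \<longrightarrow> dist (x t) (x s) < e"
    proof (intro exI[of _ "e / C"] conjI ballI impI)
      fix s t :: real assume st: "s \<in> {0..}" "t \<in> {0..}" "dist t s < e / C"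
      have "norm (x t - x s) \<le> C * \<bar>t - s\<bar>"
      proof (rule order_trans[OF lip])
        show "of_nat DIM('b) * c * \<bar>t - s\<bar> \<le> C * \<bar>t - s\<bar>"
          by (rule mult_right_mono) (use abs_ge_self[of "of_nat DIM('b) * c"] in \<open>simp_all add: C_def\<close>)
      qed (use st in auto)
      also have "\<dots> < e" using st \<open>C > 0\<close> by (simp add: dist_real_def field_simps)
      finally show "dist (x t) (x s) < e" by (simp add: dist_norm)
    qed (use \<open>e > 0\<close> \<open>C > 0\<close> in simp)
  qed
qed

lemma loc_abs_continuous_Pair:
  fixes f :: "real \<Rightarrow> 'a::real_normed_vector" and h :: "real \<Rightarrow> 'b::real_normed_vector"
  assumes "loc_abs_continuous f" "loc_abs_continuous h"
  shows "loc_abs_continuous (\<lambda>t. (f t, h t))"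
proof -
  have "bounded_linear (\<lambda>u::'a. (u, 0::'b))" "bounded_linear (\<lambda>v::'b. (0::'a, v))"
    by (intro bounded_linear_Pair bounded_linear_ident bounded_linear_zero)+
  from loc_abs_continuous_add[OF loc_abs_continuous_linear[OF this(1) assms(1)]
      loc_abs_continuous_linear[OF this(2) assms(2)]]
  show ?thesis by simp
qed

section \<open>Matrices and quadratic forms\<close>

lemma inner_matrix_vector_mult_transpose:
  fixes M :: "real^'n^'m"
  shows "(M *v x) \<bullet> y = x \<bullet> (transpose M *v y)"
  by (metis dot_lmul_matrix inner_commute transpose_matrix_vector)

text \<open>The minimum of the form over the unit sphere of the subspace is attained, hence
  positive, and homogeneity extends the bound. The trivial subspace is separate because its unit
  sphere is empty.\<close>

lemma positive_on_subspace_imp_coercive: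
  fixes M :: "real^'v^'v"
  assumes S: "subspace S" and pos: "\<And>x. x \<in> S \<Longrightarrow> x \<noteq> 0 \<Longrightarrow> 0 < x \<bullet> (M *v x)"
  obtains \<alpha> where "0 < \<alpha>" "\<And>x. x \<in> S \<Longrightarrow> \<alpha> * (x \<bullet> x) \<le> x \<bullet> (M *v x)"
proof (cases "S \<subseteq> {0}")
  case True
  then show thesis by (intro that[of 1]) auto
next
  case False
  then obtain y where y: "y \<in> S" "y \<noteq> 0" by auto
  have unit: "(1 / norm x) *\<^sub>R x \<in> sphere 0 1 \<inter> S" if "x \<in> S" "x \<noteq> 0" for x
    using that S by (simp add: subspace_scale)
  have "compact (sphere 0 1 \<inter> S)"
    by (intro compact_Int_closed closed_subspace S compact_sphere)
  moreover have "sphere 0 1 \<inter> S \<noteq> {}" using unit[OF y] by blast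
  moreover have "continuous_on (sphere 0 1 \<inter> S) (\<lambda>x. x \<bullet> (M *v x))"
    by (intro continuous_intros)
  ultimately obtain u where u: "u \<in> sphere 0 1 \<inter> S"
    and min: "\<And>x. x \<in> sphere 0 1 \<inter> S \<Longrightarrow> u \<bullet> (M *v u) \<le> x \<bullet> (M *v x)"
    using continuous_attains_inf by meson
  show thesis
  proof (rule that)
    show "0 < u \<bullet> (M *v u)" using u by (intro pos) auto
    fix x assume "x \<in> S"
    show "u \<bullet> (M *v u) * (x \<bullet> x) \<le> x \<bullet> (M *v x)"
    proof (cases "x = 0")
      case False
      have "u \<bullet> (M *v u) \<le> ((1 / norm x) *\<^sub>R x) \<bullet> (M *v ((1 / norm x) *\<^sub>R x))"
        by (rule min[OF unit[OF \<open>x \<in> S\<close> False]])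
      also have "\<dots> = (x \<bullet> (M *v x)) / (x \<bullet> x)"
        by (simp add: matrix_vector_mult_scaleR dot_square_norm power2_eq_square)
      finally show ?thesis using False by (simp add: pos_le_divide_eq)
    qed simp
  qed
qed

lemma norm_pos_proj_le: "norm (pos_proj u v) \<le> norm u"
  by (rule norm_le_componentwise_cart) (auto simp: pos_proj_def max_def)

lemma inner_nonneg_nonpos:
  fixes l v :: "real^'k"
  assumes "\<And>k. 0 \<le> l $ k" "\<And>k. v $ k \<le> 0"
  shows "l \<bullet> v \<le> 0"
  unfolding inner_vec_def by (rule sum_nonpos) (simp add: assms mult_nonneg_nonpos)

lemmas continuous_on_matrix_vector_mult =
  bounded_linear.continuous_on[OF matrix_vector_mul_bounded_linear]

lemmas tendsto_matrix_vector_mult =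
  bounded_linear.tendsto[OF matrix_vector_mul_bounded_linear]

lemma continuous_image_bounded:
  fixes \<phi> :: "'a::heine_borel \<Rightarrow> 'b::metric_space"
  assumes "bounded S" "continuous_on UNIV \<phi>"
  shows "bounded (\<phi> ` S)"
proof -
  have "compact (\<phi> ` closure S)"
    using assms by (intro compact_continuous_image) (auto simp: compact_closure intro: continuous_on_subset)
  then show ?thesis by (meson bounded_subset closure_subset compact_imp_bounded image_mono)
qed

lemma mat_pow_commute: "mat_pow S p ** S = S ** mat_pow S p"
  by (induction p) (simp_all add: matrix_mul_assoc[symmetric])

lemma transpose_mat_pow:
  assumes "transpose S = S"
  shows "transpose (mat_pow S p) = mat_pow S p"
  by (induction p) (simp_all add: matrix_transpose_mul assms mat_pow_commute)

lemma transpose_sum: "transpose (\<Sum>p\<in>I. M p) = (\<Sum>p\<in>I. transpose (M p))"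
  by (simp add: transpose_def vec_eq_iff)

lemma sum_matrix_vector_mult: "(\<Sum>p\<in>I. M p) *v x = (\<Sum>p\<in>I. M p *v x)"
  for M :: "'i \<Rightarrow> real^'n^'m"
  by (induction I rule: infinite_finite_induct) (simp_all add: matrix_vector_mult_add_rdistrib)

text \<open>Consecutive terms pair up as \<open>S\<^sup>k (I + S) S\<^sup>k\<close>, so no spectral decomposition is needed.\<close>

lemma sum_mat_pow_pos:
  fixes S :: "real^'v^'v"
  assumes sym: "transpose S = S" and pos: "\<And>x. x \<noteq> 0 \<Longrightarrow> 0 < x \<bullet> x + x \<bullet> (S *v x)"
    and "x \<noteq> 0"
  shows "0 < (\<Sum>p\<le>q. x \<bullet> (mat_pow S p *v x))"
  using \<open>x \<noteq> 0\<close>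
proof (induction q arbitrary: x rule: induct_nat_012)
  case 0
  then show ?case by simp
next
  case 1
  then show ?case using pos by simp
next
  case (ge2 q)
  \<comment> \<open>By symmetry one factor \<open>S\<close> moves to each side, so the terms after
    the first two form the same sum for \<open>q\<close> at \<open>S *v x\<close>. This vector can
    be zero, which is why only nonnegativity is drawn from the induction hypothesis.\<close>
  have shift: "x \<bullet> (mat_pow S (Suc (Suc p)) *v x) = (S *v x) \<bullet> (mat_pow S p *v (S *v x))" for p
  proof -
    have "mat_pow S (Suc (Suc p)) = S ** (mat_pow S p ** S)" by (simp add: mat_pow_commute)
    then show ?thesis
      using inner_matrix_vector_mult_transpose[of S x "mat_pow S p *v (S *v x)"] sym
      by (simp add: matrix_vector_mul_assoc[symmetric] del: mat_pow.simps)
  qed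
  have "(\<Sum>p\<le>Suc (Suc q). x \<bullet> (mat_pow S p *v x)) =
      (x \<bullet> x + x \<bullet> (S *v x)) + (\<Sum>p\<le>q. (S *v x) \<bullet> (mat_pow S p *v (S *v x)))"
    by (subst sum.atMost_Suc_shift, subst sum.atMost_Suc_shift, simp only: shift) simp
  moreover have "0 \<le> (\<Sum>p\<le>q. (S *v x) \<bullet> (mat_pow S p *v (S *v x)))"
    using ge2.IH(1)[of "S *v x"] by (cases "S *v x = 0") simp_all
  ultimately show ?case using pos[OF ge2.prems] by linarith
qed

lemma diag_mat_mult_nth: "(diag_mat a *v x) $ i = a $ i * x $ i"
proof -
  have "(if i = j then a $ i else 0) * x $ j = (if i = j then a $ i * x $ i else 0)" for j
    by simp
  then show ?thesis by (simp add: matrix_vector_mult_def diag_mat_def del: mult_eq_0_iff)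
qed

lemma transpose_diag_mat: "transpose (diag_mat a) = diag_mat a"
  by (auto simp: transpose_def diag_mat_def vec_eq_iff)

section \<open>Quadratic programs\<close>

text \<open>\<open>Q\<close> stands for L H L, \<open>e\<close> for the all-ones vector and
  \<open>C\<close> for the rows of -L and L. Cost and constraints do not see the direction
  \<open>e\<close>; as \<open>e\<close> is an eigenvector of \<open>A\<close>, the preconditioned
  flow does not move along it either.\<close>

locale preconditioned_qp =
  fixes Q A :: "real^'v^'v" and C :: "real^'v^'k" and c e :: "real^'v" and p :: "real^'k"
    and k0 \<kappa> :: real
  assumes Q_sym: "transpose Q = Q" and A_sym: "transpose A = A"
    and A_pos: "\<And>x. x \<noteq> 0 \<Longrightarrow> 0 < x \<bullet> (A *v x)"
    and e_nz: "e \<noteq> 0" and Q_e: "Q *v e = 0" and C_e: "C *v e = 0" and c_e: "c \<bullet> e = 0"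
    and Q_pos: "\<And>x. x \<bullet> e = 0 \<Longrightarrow> x \<noteq> 0 \<Longrightarrow> 0 < x \<bullet> (Q *v x)"
    and A_e: "A *v e = \<kappa> *\<^sub>R e"
begin

definition cost :: "real^'v \<Rightarrow> real" where
  "cost y = (y \<bullet> (Q *v y)) / 2 + c \<bullet> y + k0"

definition constr :: "real^'v \<Rightarrow> real^'k" where
  "constr y = C *v y + p"

definition lag_grad :: "real^'v \<Rightarrow> real^'k \<Rightarrow> real^'v" where
  "lag_grad y l = Q *v y + c + transpose C *v l"

definition kkt :: "real^'v \<Rightarrow> real^'k \<Rightarrow> bool" where
  "kkt y l \<longleftrightarrow> (\<forall>k. 0 \<le> l $ k) \<and> (\<forall>k. constr y $ k \<le> 0) \<and> l \<bullet> constr y = 0 \<and> lag_grad y l = 0"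

lemma Q_inner_sym: "x \<bullet> (Q *v y) = y \<bullet> (Q *v x)"
  using inner_matrix_vector_mult_transpose[of Q x y] Q_sym by (simp add: inner_commute)

lemma A_inner_sym: "x \<bullet> (A *v y) = y \<bullet> (A *v x)"
  using inner_matrix_vector_mult_transpose[of A x y] A_sym by (simp add: inner_commute)

lemma Q_shift: "(x + s *\<^sub>R e) \<bullet> (Q *v (x + s *\<^sub>R e)) = x \<bullet> (Q *v x)"
  using Q_inner_sym[of e x]
  by (simp add: matrix_vector_right_distrib matrix_vector_mult_scaleR Q_e inner_add_left)

lemma decompose:
  obtains x' s where "x = x' + s *\<^sub>R e" "x' \<bullet> e = 0"
proof -
  define s where "s = (x \<bullet> e) / (e \<bullet> e)"
  have "(x - s *\<^sub>R e) \<bullet> e = 0" using e_nz by (simp add: inner_diff_left s_def)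
  then show thesis using that[of "x - s *\<^sub>R e" s] by simp
qed

lemma Q_nonneg: "0 \<le> x \<bullet> (Q *v x)"
proof -
  obtain x' s where x: "x = x' + s *\<^sub>R e" "x' \<bullet> e = 0" using decompose by blast
  show ?thesis unfolding x(1) Q_shift using Q_pos[OF x(2)] by (cases "x' = 0") auto
qed

lemma Q_coercive:
  obtains \<alpha> where "0 < \<alpha>" "\<And>x. x \<bullet> e = 0 \<Longrightarrow> \<alpha> * (x \<bullet> x) \<le> x \<bullet> (Q *v x)"
proof -
  have "subspace {x. x \<bullet> e = 0}" using subspace_hyperplane[of e] by (simp add: inner_commute)
  then obtain \<alpha> where "0 < \<alpha>" and \<alpha>: "\<And>x. x \<in> {x. x \<bullet> e = 0} \<Longrightarrow> \<alpha> * (x \<bullet> x) \<le> x \<bullet> (Q *v x)"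
    by (rule positive_on_subspace_imp_coercive[where M = Q]) (simp_all add: Q_pos)
  show thesis by (rule that[OF \<open>0 < \<alpha>\<close> \<alpha>]) simp
qed

lemma constr_diff: "constr y - constr y' = C *v (y - y')"
  by (simp add: constr_def matrix_vector_mult_diff_distrib)

lemma lag_grad_diff:
  "lag_grad y l - lag_grad y' l' = Q *v (y - y') + transpose C *v (l - l')"
  by (simp add: lag_grad_def matrix_vector_mult_diff_distrib)

text \<open>The expansion is exact because the Lagrangian is quadratic in \<open>y\<close>; it
  serves both directions of the equivalence between saddle points and KKT pairs.\<close>

lemma lagrangian_expand:
  "lagrangian cost constr y l =
     lagrangian cost constr y' l + (y - y') \<bullet> lag_grad y' l + ((y - y') \<bullet> (Q *v (y - y'))) / 2"
proof -
  define h where "h = y - y'"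
  have y: "y = y' + h" by (simp add: h_def)
  have "(y' + h) \<bullet> (Q *v (y' + h)) = y' \<bullet> (Q *v y') + 2 * (h \<bullet> (Q *v y')) + h \<bullet> (Q *v h)"
    using Q_inner_sym[of y' h] by (simp add: matrix_vector_right_distrib inner_add_left inner_add_right)
  moreover have "l \<bullet> (C *v h) = h \<bullet> (transpose C *v l)"
    using inner_matrix_vector_mult_transpose[of C h l] by (simp add: inner_commute)
  ultimately show ?thesis unfolding y lagrangian_def cost_def constr_def lag_grad_def
    by (simp add: matrix_vector_right_distrib inner_add_left inner_add_right inner_commute[of c] field_simps)
qed

section \<open>Saddle points as KKT pairs\<close>

lemma kkt_imp_optimal_point:
  assumes "kkt y l"
  shows "optimal_point cost constr y l"
  unfolding optimal_point_def
proof (intro conjI allI impI)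
  fix l' :: "real^'k" assume "\<forall>k. 0 \<le> l' $ k"
  then have "l' \<bullet> constr y \<le> 0"
    using assms by (intro inner_nonneg_nonpos) (simp_all add: kkt_def)
  then show "lagrangian cost constr y l' \<le> lagrangian cost constr y l"
    using assms by (simp add: lagrangian_def kkt_def)
next
  fix y'
  show "lagrangian cost constr y l \<le> lagrangian cost constr y' l"
    using assms Q_nonneg[of "y' - y"] lagrangian_expand[of y' l y] by (simp add: kkt_def)
qed (use assms in \<open>auto simp: kkt_def\<close>)

lemma optimal_point_imp_kkt:
  assumes opt: "optimal_point cost constr y l"
  shows "kkt y l"
proof -
  have l: "\<And>k. 0 \<le> l $ k"
    and dual: "\<And>l'. (\<And>k. 0 \<le> l' $ k) \<Longrightarrow> l' \<bullet> constr y \<le> l \<bullet> constr y"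
    and primal: "\<And>y'. lagrangian cost constr y l \<le> lagrangian cost constr y' l"
    using opt unfolding optimal_point_def by (auto simp: lagrangian_def)
  have feas: "constr y $ k \<le> 0" for k
  proof -
    \<comment> \<open>Raising one multiplier by 1 cannot increase the Lagrangian, which forces the
      corresponding constraint.\<close>
    have "(l + axis k 1) \<bullet> constr y \<le> l \<bullet> constr y"
      by (rule dual) (use l in \<open>simp add: axis_def add_nonneg_nonneg\<close>)
    then show ?thesis by (simp add: inner_add_left inner_axis')
  qed
  have "l \<bullet> constr y \<le> 0"
    using l feas by (rule inner_nonneg_nonpos)
  moreover have "0 \<le> l \<bullet> constr y" using dual[of 0] by simp
  moreover have "lag_grad y l = 0"
  proof (rule ccontr)
    assume "lag_grad y l \<noteq> 0"
    define G where "G = lag_grad y l"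
    define K where "K = G \<bullet> (Q *v G)"
    \<comment> \<open>The step \<open>- t *\<^sub>R G\<close> changes the Lagrangian by
      \<open>- t * (G \<bullet> G) + t * t * K / 2\<close>, which is negative for this
      \<open>t\<close>; the added 1 covers \<open>K = 0\<close>.\<close>
    define t where "t = (G \<bullet> G) / (K + 1)"
    have "K \<ge> 0" "G \<bullet> G > 0" using \<open>lag_grad y l \<noteq> 0\<close> Q_nonneg by (auto simp: K_def G_def)
    then have "t > 0" by (simp add: t_def)
    have "0 \<le> (- t *\<^sub>R G) \<bullet> G + ((- t *\<^sub>R G) \<bullet> (Q *v (- t *\<^sub>R G))) / 2"
      using primal[of "y - t *\<^sub>R G"] lagrangian_expand[of "y - t *\<^sub>R G" l y] by (simp add: G_def)
    then have "0 \<le> t * (t * K / 2 - G \<bullet> G)"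
      by (simp only: matrix_vector_mult_scaleR inner_scaleR_left inner_scaleR_right flip: K_def)
         (simp add: algebra_simps)
    then have "G \<bullet> G \<le> t * K / 2" using \<open>t > 0\<close> by (simp add: zero_le_mult_iff)
    moreover have "t * (K + 1) = G \<bullet> G" using \<open>K \<ge> 0\<close> by (simp add: t_def)
    moreover have "t * K \<ge> 0" using \<open>K \<ge> 0\<close> \<open>t > 0\<close> by simp
    ultimately show False using \<open>t > 0\<close> by (simp add: algebra_simps)
  qed
  ultimately show ?thesis using l feas by (simp add: kkt_def)
qed

lemma optimal_point_iff_kkt: "optimal_point cost constr y l \<longleftrightarrow> kkt y l"
  using kkt_imp_optimal_point optimal_point_imp_kkt by blast

text \<open>Testing the difference of the two stationarity equations with \<open>y - y'\<close> and
  using complementarity turns the quadratic form into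
  \<open>l' \<bullet> constr y + l \<bullet> constr y'\<close>, which is nonpositive. The
  multipliers may well differ.\<close>

lemma kkt_unique:
  assumes "kkt y l" "kkt y' l'" "y \<bullet> e = y' \<bullet> e"
  shows "y = y'"
proof -
  have "0 = (y - y') \<bullet> (lag_grad y l - lag_grad y' l')" using assms by (simp add: kkt_def)
  also have "\<dots> = (y - y') \<bullet> (Q *v (y - y')) + (constr y - constr y') \<bullet> (l - l')"
    by (simp add: lag_grad_diff constr_diff inner_add_right inner_matrix_vector_mult_transpose)
  also have "(constr y - constr y') \<bullet> (l - l') = - (l' \<bullet> constr y) - l \<bullet> constr y'"
    using assms by (simp add: kkt_def inner_diff_left inner_diff_right inner_commute)
  finally have "(y - y') \<bullet> (Q *v (y - y')) = l' \<bullet> constr y + l \<bullet> constr y'" by simp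
  moreover have "l' \<bullet> constr y \<le> 0" "l \<bullet> constr y' \<le> 0"
    by (intro inner_nonneg_nonpos; use assms in \<open>simp add: kkt_def\<close>)+
  ultimately have "\<not> 0 < (y - y') \<bullet> (Q *v (y - y'))" by simp
  moreover have "(y - y') \<bullet> e = 0" using assms(3) by (simp add: inner_diff_left)
  ultimately show ?thesis using Q_pos by force
qed

lemma cost_shift: "cost (y + s *\<^sub>R e) = cost y"
  by (simp add: cost_def Q_shift inner_add_right c_e)

lemma constr_shift: "constr (y + s *\<^sub>R e) = constr y"
  by (simp add: constr_def matrix_vector_right_distrib matrix_vector_mult_scaleR C_e)

section \<open>Existence of KKT pairs under Slater's condition\<close>

text \<open>The cost is constant along \<open>e\<close>, so minimizers come in whole lines. One is
  found on the hyperplane through 0 orthogonal to \<open>e\<close>, where sublevel sets are compact,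
  and is then shifted along \<open>e\<close> to the prescribed value \<open>m\<close>.\<close>

lemma exists_primal_minimizer:
  assumes feas: "\<And>k. constr y0 $ k \<le> 0"
  obtains y where "\<And>k. constr y $ k \<le> 0" "y \<bullet> e = m"
    "\<And>y'. (\<And>k. constr y' $ k \<le> 0) \<Longrightarrow> cost y \<le> cost y'"
proof -
  obtain \<alpha> where "0 < \<alpha>" and \<alpha>: "\<And>x. x \<bullet> e = 0 \<Longrightarrow> \<alpha> * (x \<bullet> x) \<le> x \<bullet> (Q *v x)"
    using Q_coercive by blast
  obtain y1 s1 where y1: "y0 = y1 + s1 *\<^sub>R e" "y1 \<bullet> e = 0" using decompose by blast
  define S where "S = {y. y \<bullet> e = 0 \<and> (\<forall>k. constr y $ k \<le> 0) \<and> cost y \<le> cost y1}"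
  have "y1 \<in> S" using y1 feas by (simp add: S_def constr_shift)
  have "closed S"
    unfolding S_def constr_def cost_def
    by (intro closed_Collect_conj closed_Collect_all closed_Collect_le closed_Collect_eq continuous_intros) simp_all
  moreover have "bounded S"
  proof -
    \<comment> \<open>Outside radius 1 the constant term is absorbed into the linear one, and beyond
      \<open>B\<close> the quadratic term outgrows both; the final 1 guarantees
      \<open>B \<ge> 1\<close>.\<close>
    define B where "B = 2 * (norm c + \<bar>cost y1 - k0\<bar>) / \<alpha> + 1"
    have "norm y \<le> B" if "y \<in> S" for y
    proof (rule ccontr)
      assume "\<not> norm y \<le> B"
      then have "B < norm y" by simp
      have "B \<ge> 1" using \<open>0 < \<alpha>\<close> by (simp add: B_def)
      then have "norm y > 1" using \<open>B < norm y\<close> by simp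
      have "\<alpha> / 2 * (norm y * norm y) - norm c * norm y \<le> cost y - k0"
        using \<alpha>[of y] that Cauchy_Schwarz_ineq2[of c y]
        by (simp add: S_def cost_def dot_square_norm power2_eq_square)
      also have "\<dots> \<le> \<bar>cost y1 - k0\<bar> * 1" using that abs_ge_self[of "cost y1 - k0"] by (simp add: S_def)
      also have "\<dots> \<le> \<bar>cost y1 - k0\<bar> * norm y"
        using \<open>norm y > 1\<close> by (intro mult_left_mono) auto
      finally have "norm y * (\<alpha> / 2 * norm y) \<le> norm y * (norm c + \<bar>cost y1 - k0\<bar>)"
        by (simp add: algebra_simps)
      then have "\<alpha> / 2 * norm y \<le> norm c + \<bar>cost y1 - k0\<bar>"
        by (rule mult_left_le_imp_le) (use \<open>norm y > 1\<close> in linarith)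
      then have "norm y \<le> 2 * (norm c + \<bar>cost y1 - k0\<bar>) / \<alpha>"
        using \<open>0 < \<alpha>\<close> by (simp add: field_simps)
      then show False using \<open>B < norm y\<close> by (simp add: B_def)
    qed
    then show ?thesis by (auto simp: bounded_iff)
  qed
  ultimately have "compact S" by (simp add: compact_eq_bounded_closed)
  moreover have "continuous_on S cost" unfolding cost_def by (intro continuous_intros) simp_all
  ultimately obtain y where "y \<in> S" and y: "\<And>y'. y' \<in> S \<Longrightarrow> cost y \<le> cost y'"
    using continuous_attains_inf[of S cost] \<open>y1 \<in> S\<close> by blast
  show thesis
  proof (rule that[of "y + (m / (e \<bullet> e)) *\<^sub>R e"])
    show "constr (y + (m / (e \<bullet> e)) *\<^sub>R e) $ k \<le> 0" for k
      using \<open>y \<in> S\<close> by (simp add: constr_shift S_def)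
    show "(y + (m / (e \<bullet> e)) *\<^sub>R e) \<bullet> e = m"
      using \<open>y \<in> S\<close> e_nz by (simp add: inner_add_left S_def)
    fix y' assume feas': "\<And>k. constr y' $ k \<le> 0"
    obtain y2 s2 where y2: "y' = y2 + s2 *\<^sub>R e" "y2 \<bullet> e = 0" using decompose by blast
    have "cost y \<le> cost y2"
    proof (cases "cost y2 \<le> cost y1")
      case True
      then show ?thesis using y2 feas' by (intro y) (simp add: S_def constr_shift)
    next
      case False
      then show ?thesis using y[OF \<open>y1 \<in> S\<close>] by simp
    qed
    then show "cost (y + (m / (e \<bullet> e)) *\<^sub>R e) \<le> cost y'" by (simp add: cost_shift y2)
  qed
qed

lemma cost_convex: "convex_on UNIV cost"
proof (rule convex_onI)
  fix t :: real and x y :: "real^'v" assume t: "0 < t" "t < 1"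
  have "(1 - t) * cost x + t * cost y - cost ((1 - t) *\<^sub>R x + t *\<^sub>R y)
      = t * (1 - t) / 2 * ((x - y) \<bullet> (Q *v (x - y)))"
    using Q_inner_sym[of x y] unfolding cost_def
    by (simp add: matrix_vector_right_distrib matrix_vector_mult_scaleR matrix_vector_mult_diff_distrib
        inner_add_left inner_add_right inner_diff_left inner_diff_right)
       (simp add: field_simps)
  also have "\<dots> \<ge> 0" using t Q_nonneg by simp
  finally show "cost ((1 - t) *\<^sub>R x + t *\<^sub>R y) \<le> (1 - t) * cost x + t * cost y" by simp
qed simp

text \<open>The multiplier comes from separating \<open>0\<close> from the convex set of attainable
  (constraint bound, cost excess) pairs; Slater's condition excludes a vertical hyperplane.\<close>

lemma exists_multiplier:
  assumes slater: "\<And>k. constr y0 $ k < 0"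
    and feas: "\<And>k. constr y $ k \<le> 0"
    and min: "\<And>y'. (\<And>k. constr y' $ k \<le> 0) \<Longrightarrow> cost y \<le> cost y'"
  obtains l where "kkt y l"
proof -
  \<comment> \<open>The strict inequality keeps 0 out of \<open>S\<close>, since \<open>y\<close>
    itself has cost excess 0. The price is a passage to the limit when \<open>lower\<close> is
    derived.\<close>
  define S where "S = {(u, s) | u s. \<exists>y'. (\<forall>k. constr y' $ k \<le> u $ k) \<and> cost y' - cost y < s}"
  have "convex S"
  proof (rule convexI)
    fix x1 x2 :: "(real^'k) \<times> real" and a b :: real
    assume ab: "x1 \<in> S" "x2 \<in> S" "0 \<le> a" "0 \<le> b" "a + b = 1"
    obtain u1 s1 y1 where 1: "x1 = (u1, s1)" "\<And>k. constr y1 $ k \<le> u1 $ k" "cost y1 - cost y < s1"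
      using ab(1) by (auto simp: S_def)
    obtain u2 s2 y2 where 2: "x2 = (u2, s2)" "\<And>k. constr y2 $ k \<le> u2 $ k" "cost y2 - cost y < s2"
      using ab(2) by (auto simp: S_def)
    let ?y = "a *\<^sub>R y1 + b *\<^sub>R y2"
    have "constr ?y = a *\<^sub>R constr y1 + b *\<^sub>R constr y2"
      using ab(5) by (simp add: constr_def matrix_vector_right_distrib matrix_vector_mult_scaleR
          algebra_simps flip: scaleR_add_left)
    then have "constr ?y $ k \<le> (a *\<^sub>R u1 + b *\<^sub>R u2) $ k" for k
      using ab 1(2)[of k] 2(2)[of k] by (simp add: add_mono mult_left_mono)
    moreover have "cost ?y - cost y < a * s1 + b * s2"
    proof -
      have "cost ?y \<le> a * cost y1 + b * cost y2"
        using cost_convex ab by (simp add: convex_on_def)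
      then have "cost ?y - cost y \<le> a * (cost y1 - cost y) + b * (cost y2 - cost y)"
      proof -
        have "cost y = a * cost y + b * cost y" using ab(5) by (metis distrib_right mult_1)
        with \<open>cost ?y \<le> a * cost y1 + b * cost y2\<close> show ?thesis unfolding right_diff_distrib by linarith
      qed
      also have "\<dots> < a * s1 + b * s2"
      proof (cases "a = 0")
        case True
        then show ?thesis using ab 2 by simp
      next
        case False
        then show ?thesis using ab 1(3) 2(3)
          by (intro add_less_le_mono mult_strict_left_mono mult_left_mono) auto
      qed
      finally show ?thesis .
    qed
    ultimately show "a *\<^sub>R x1 + b *\<^sub>R x2 \<in> S" unfolding S_def 1 2 by auto
  qed
  moreover have "0 \<notin> S"
  proof
    assume "0 \<in> S"
    then obtain y' where "\<forall>k. constr y' $ k \<le> 0" "cost y' - cost y < 0"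
      by (auto simp: S_def zero_prod_def)
    then show False using min[of y'] by simp
  qed
  ultimately have "\<exists>\<nu>. \<nu> \<noteq> 0 \<and> (\<forall>x\<in>S. 0 \<le> \<nu> \<bullet> x)"
    by (rule separating_hyperplane_set_0)
  then obtain \<nu> where "\<nu> \<noteq> 0" and \<nu>: "\<And>x. x \<in> S \<Longrightarrow> 0 \<le> \<nu> \<bullet> x"
    by auto
  obtain l \<tau> where l\<tau>: "\<nu> = (l, \<tau>)" by (cases \<nu>)
  have sep: "0 \<le> l \<bullet> u + \<tau> * s" if "\<And>k. constr y' $ k \<le> u $ k" "cost y' - cost y < s" for u s y'
  proof -
    have "(u, s) \<in> S" using that by (auto simp: S_def)
    from \<nu>[OF this] show ?thesis by (simp add: l\<tau>)
  qed
  have l: "0 \<le> l $ k" for k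
  proof (rule ccontr)
    assume "\<not> 0 \<le> l $ k"
    \<comment> \<open>Bounds in \<open>S\<close> can be relaxed at will; if
      \<open>l $ k < 0\<close>, relaxing the k-th one by \<open>r\<close> brings the separating
      functional down to at most -1.\<close>
    define r where "r = (\<bar>l \<bullet> constr y + \<tau>\<bar> + 1) / - (l $ k)"
    have "r > 0" using \<open>\<not> 0 \<le> l $ k\<close> unfolding r_def by (intro divide_pos_pos) auto
    have "0 \<le> l \<bullet> (constr y + r *\<^sub>R axis k 1) + \<tau> * 1"
      by (rule sep[of y]) (use \<open>r > 0\<close> in \<open>auto simp: axis_def\<close>)
    also have "\<dots> = l \<bullet> constr y + \<tau> + r * l $ k"
      by (simp add: inner_add_right inner_axis)
    also have "r * l $ k = - (\<bar>l \<bullet> constr y + \<tau>\<bar> + 1)"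
      using \<open>\<not> 0 \<le> l $ k\<close> by (simp add: r_def)
    finally show False by linarith
  qed
  have "0 \<le> \<tau>"
  proof (rule ccontr)
    assume "\<not> 0 \<le> \<tau>"
    define s where "s = (\<bar>l \<bullet> constr y\<bar> + 1) / - \<tau>"
    have "s > 0" using \<open>\<not> 0 \<le> \<tau>\<close> unfolding s_def by (intro divide_pos_pos) auto
    have "0 \<le> l \<bullet> constr y + \<tau> * s"
      by (rule sep[of y]) (use \<open>s > 0\<close> in auto)
    also have "\<tau> * s = - (\<bar>l \<bullet> constr y\<bar> + 1)"
      using \<open>\<not> 0 \<le> \<tau>\<close> by (simp add: s_def)
    finally show False by linarith
  qed
  have "\<tau> \<noteq> 0"
  proof
    assume "\<tau> = 0"
    then have "l \<noteq> 0" using \<open>\<nu> \<noteq> 0\<close> by (simp add: l\<tau> zero_prod_def)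
    then obtain k where "l $ k > 0" using l by (metis less_eq_real_def vec_eq_iff zero_index)
    have "0 \<le> l \<bullet> constr y0"
      using sep[of y0 "constr y0" "cost y0 - cost y + 1"] \<open>\<tau> = 0\<close> by simp
    moreover have "0 < (\<Sum>k\<in>UNIV. l $ k * - (constr y0 $ k))"
      using l slater \<open>l $ k > 0\<close>
      by (intro sum_pos2[of UNIV k] mult_pos_pos mult_nonneg_nonneg) (auto simp: less_imp_le)
    then have "l \<bullet> constr y0 < 0" by (simp add: inner_vec_def sum_negf)
    ultimately show False by simp
  qed
  then have "\<tau> > 0" using \<open>0 \<le> \<tau>\<close> by simp
  define l' where "l' = (1 / \<tau>) *\<^sub>R l"
  have l': "0 \<le> l' $ k" for k using l \<open>\<tau> > 0\<close> by (simp add: l'_def)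
  have lower: "0 \<le> l' \<bullet> constr y' + (cost y' - cost y)" for y'
  proof (rule field_le_epsilon)
    fix r :: real assume "r > 0"
    have "0 \<le> l \<bullet> constr y' + \<tau> * (cost y' - cost y + r)"
      by (rule sep[of y']) (use \<open>r > 0\<close> in auto)
    then have "0 \<le> (l \<bullet> constr y' + \<tau> * (cost y' - cost y + r)) / \<tau>" using \<open>\<tau> > 0\<close> by simp
    also have "\<dots> = l' \<bullet> constr y' + (cost y' - cost y) + r"
      using \<open>\<tau> > 0\<close> by (simp add: l'_def add_divide_distrib)
    finally show "0 \<le> l' \<bullet> constr y' + (cost y' - cost y) + r" .
  qed
  have "l'' \<bullet> constr y \<le> 0" if "\<And>k. 0 \<le> l'' $ k" for l''
    using that feas by (rule inner_nonneg_nonpos)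
  moreover have "l' \<bullet> constr y = 0" using lower[of y] calculation[OF l'] by simp
  ultimately have "optimal_point cost constr y l'"
    using l' lower unfolding optimal_point_def lagrangian_def by (auto simp: algebra_simps)
  then show thesis using that optimal_point_imp_kkt by blast
qed

lemma exists_kkt:
  assumes "\<And>k. constr y0 $ k < 0"
  obtains y l where "kkt y l" "y \<bullet> e = m"
  using exists_primal_minimizer[of y0 m] exists_multiplier[OF assms] assms
  by (metis less_imp_le)

text \<open>\<open>B\<close> is the metric of the Lyapunov function: the left inverse property
  removes \<open>A\<close> from the derivative along the flow, and positivity gives
  coercivity.\<close>

lemma exists_inverse_A:
  obtains B where "transpose B = B" "\<And>x. B *v (A *v x) = x" "\<And>x. x \<noteq> 0 \<Longrightarrow> 0 < x \<bullet> (B *v x)"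
proof -
  have "inj ((*v) A)"
  proof (rule injI)
    fix x y assume "A *v x = A *v y"
    then have "(x - y) \<bullet> (A *v (x - y)) = 0" by (simp add: matrix_vector_mult_diff_distrib)
    then show "x = y" using A_pos[of "x - y"] by force
  qed
  then obtain B where B: "B ** A = mat 1" using matrix_left_invertible_injective by blast
  then have B': "A ** B = mat 1" by (simp add: matrix_left_right_inverse)
  have BA: "B *v (A *v x) = x" and AB: "A *v (B *v x) = x" for x
    using B B' by (simp_all add: matrix_vector_mul_assoc)
  have "x \<bullet> (transpose B *v y) = x \<bullet> (B *v y)" for x y
    using A_inner_sym[of "B *v x" "B *v y"] inner_matrix_vector_mult_transpose[of B x y]
    by (simp add: AB inner_commute)
  then have "transpose B = B" by (metis matrix_eq vector_eq_ldot)
  moreover have "0 < x \<bullet> (B *v x)" if "x \<noteq> 0" for x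
  proof -
    have "B *v x \<noteq> 0" using that AB[of x] by force
    from A_pos[OF this] show ?thesis by (simp add: AB inner_commute)
  qed
  ultimately show thesis using that BA by blast
qed

lemma grad_lagrangian_primal: "grad (\<lambda>y. lagrangian cost constr y l) y = lag_grad y l"
proof (rule grad_eq, unfold gderiv_def)
  have "((\<lambda>y. (y \<bullet> (Q *v y)) / 2 + c \<bullet> y + k0 + l \<bullet> (C *v y + p)) has_derivative
      (\<lambda>h. (y \<bullet> (Q *v h) + h \<bullet> (Q *v y)) / 2 + c \<bullet> h + l \<bullet> (C *v h))) (at y)"
    by (auto intro!: derivative_eq_intros bounded_linear.has_derivative[OF matrix_vector_mul_bounded_linear])
  moreover have "(y \<bullet> (Q *v h) + h \<bullet> (Q *v y)) / 2 + c \<bullet> h + l \<bullet> (C *v h) = h \<bullet> lag_grad y l" for h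
    using Q_inner_sym[of y h] inner_matrix_vector_mult_transpose[of C h l]
    by (simp add: lag_grad_def inner_add_right inner_commute)
  ultimately show "((\<lambda>y. lagrangian cost constr y l) has_derivative (\<lambda>h. h \<bullet> lag_grad y l)) (at y)"
    by (simp add: lagrangian_def cost_def constr_def)
qed

lemma grad_lagrangian_dual: "grad (\<lambda>l. lagrangian cost constr y l) l = constr y"
  unfolding lagrangian_def
  by (rule grad_eq, unfold gderiv_def) (auto intro!: derivative_eq_intros)

end

section \<open>Saddle-point flows\<close>

text \<open>Slater's condition stays out of the flow analysis; it enters only through the existence
  of a KKT pair.\<close>

locale preconditioned_saddle_flow = preconditioned_qp Q A C c e p k0 \<kappa>
  for Q A :: "real^'v^'v" and C :: "real^'v^'k" and c e :: "real^'v" and p :: "real^'k"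
    and k0 \<kappa> :: real +
  fixes z :: "real \<Rightarrow> real^'v" and lam :: "real \<Rightarrow> real^'k"
  assumes z_ac: "loc_abs_continuous z" and lam_ac: "loc_abs_continuous lam"
    and flow: "AE t in lebesgue. 0 \<le> t \<longrightarrow>
      (z has_vector_derivative - (A *v lag_grad (z t) (lam t))) (at t within {0..}) \<and>
      (lam has_vector_derivative pos_proj (constr (z t)) (lam t)) (at t within {0..})"
    and lam_0: "\<And>k. 0 \<le> lam 0 $ k"
    and kkt_exists: "\<exists>y l. kkt y l"
begin

section \<open>Invariants of the flow\<close>

text \<open>After the last time at which the component is nonnegative it is strictly negative, so
  the projection makes its derivative nonnegative and it cannot have dropped.\<close>

lemma lam_nonneg:
  assumes "0 \<le> t"
  shows "0 \<le> lam t $ k"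
proof (rule ccontr)
  assume neg: "\<not> 0 \<le> lam t $ k"
  have ac: "loc_abs_continuous (\<lambda>t. lam t $ k)"
    by (rule loc_abs_continuous_linear[of "\<lambda>v. v $ k", OF bounded_linear_vec_nth lam_ac])
  define S where "S = {s \<in> {0..t}. 0 \<le> lam s $ k}"
  have "S = {0..t} \<inter> (\<lambda>s. lam s $ k) -` {0..}" by (auto simp: S_def)
  then have "closed S"
    using continuous_closed_preimage[OF loc_abs_continuous_imp_continuous_on[OF ac, of 0 t] closed_atLeastAtMost closed_atLeast]
    by simp
  moreover have "bounded S" unfolding S_def by (rule bounded_subset[of "{0..t}"]) auto
  moreover have "0 \<in> S" using assms lam_0 by (simp add: S_def)
  ultimately obtain s where s: "s \<in> S" "\<And>r. r \<in> S \<Longrightarrow> r \<le> s"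
    using compact_attains_sup[of S] by (auto simp: compact_eq_bounded_closed)
  have "lam s $ k \<le> lam t $ k"
  proof (rule loc_abs_continuous_AE_nonneg_imp_le[of s t "\<lambda>t. lam t $ k", OF _ _ ac])
    \<comment> \<open>At \<open>s\<close> the component is still nonnegative, so the sign argument
      starts only after it; a single point is negligible.\<close>
    have "AE r in lebesgue. r \<noteq> s"
      by (intro AE_I'[of "{s}"]) (auto simp: null_sets_def)
    with flow show "AE r in lebesgue. s \<le> r \<and> r \<le> t \<longrightarrow>
        (\<exists>D\<ge>0. ((\<lambda>t. lam t $ k) has_vector_derivative D) (at r within {0..}))"
    proof eventually_elim
      case (elim r)
      show ?case
      proof
        assume r: "s \<le> r \<and> r \<le> t"
        then have "0 \<le> r" using s(1) by (simp add: S_def)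
        have "r \<notin> S" using s(2)[of r] r elim by auto
        then have "lam r $ k < 0" using r \<open>0 \<le> r\<close> by (simp add: S_def)
        then have "0 \<le> pos_proj (constr (z r)) (lam r) $ k" by (simp add: pos_proj_def)
        moreover have "((\<lambda>t. lam t $ k) has_vector_derivative pos_proj (constr (z r)) (lam r) $ k) (at r within {0..})"
          using elim \<open>0 \<le> r\<close> bounded_linear.has_vector_derivative[OF bounded_linear_vec_nth[of k]] by blast
        ultimately show "\<exists>D\<ge>0. ((\<lambda>t. lam t $ k) has_vector_derivative D) (at r within {0..})" by blast
      qed
    qed
  qed (use s in \<open>auto simp: S_def\<close>)
  then show False using s(1) neg by (simp add: S_def)
qed

text \<open>The gradient is orthogonal to \<open>e\<close>, and the symmetric matrix
  \<open>A\<close> with eigenvector \<open>e\<close> preserves the orthogonal complement of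
  \<open>e\<close>.\<close>

lemma z_inner_e:
  assumes "0 \<le> t"
  shows "z t \<bullet> e = z 0 \<bullet> e"
proof -
  have ac: "loc_abs_continuous (\<lambda>t. z t \<bullet> e)"
    by (intro loc_abs_continuous_inner loc_abs_continuous_const z_ac)
  have "lag_grad y l \<bullet> e = 0" for y l
    using Q_inner_sym[of e y] inner_matrix_vector_mult_transpose[of C e l]
    by (simp add: lag_grad_def inner_add_left c_e Q_e C_e inner_commute[of "Q *v y"]
        inner_commute[of "transpose C *v l"] del: transpose_matrix_vector)
  then have orth: "(A *v lag_grad y l) \<bullet> e = 0" for y l
    using A_inner_sym[of e "lag_grad y l"] by (simp add: A_e inner_commute)
  have der: "AE t in lebesgue. 0 \<le> t \<longrightarrow> ((\<lambda>t. z t \<bullet> e) has_vector_derivative 0) (at t within {0..})"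
    using flow
  proof eventually_elim
    case (elim t)
    then show ?case
      using bounded_linear.has_vector_derivative[OF bounded_linear_inner_left[of e], of z
          "- (A *v lag_grad (z t) (lam t))" "at t within {0..}"] by (simp add: orth)
  qed
  have "\<bar>z t \<bullet> e - z 0 \<bullet> e\<bar> \<le> 0 * \<bar>t - 0\<bar>"
    by (rule loc_abs_continuous_bounded_derivative_lipschitz[OF ac])
       (use der assms in \<open>auto elim!: eventually_mono\<close>)
  then show ?thesis by simp
qed

section \<open>Decay of the Lyapunov function\<close>

text \<open>A function of the state rather than of time, so that uniform continuity along the
  trajectory follows from continuity and boundedness.\<close>

definition dissipation :: "real^'v \<Rightarrow> (real^'v) \<times> (real^'k) \<Rightarrow> real" where
  "dissipation y x = (fst x - y) \<bullet> (Q *v (fst x - y)) - snd x \<bullet> constr y"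

lemma dissipation_nonneg:
  assumes "kkt y l" "0 \<le> t"
  shows "0 \<le> - (lam t \<bullet> constr y)" "0 \<le> dissipation y (z t, lam t)"
proof -
  have "lam t \<bullet> constr y \<le> 0"
    using assms by (intro inner_nonneg_nonpos) (simp_all add: kkt_def lam_nonneg)
  then show "0 \<le> - (lam t \<bullet> constr y)" "0 \<le> dissipation y (z t, lam t)"
    using Q_nonneg[of "z t - y"] by (simp_all add: dissipation_def)
qed

definition lyapunov :: "real^'v^'v \<Rightarrow> real^'v \<Rightarrow> real^'k \<Rightarrow> real \<Rightarrow> real" where
  "lyapunov B y l t = (1 / 2) * ((z t - y) \<bullet> (B *v (z t - y))) + (1 / 2) * ((lam t - l) \<bullet> (lam t - l))"

lemma lyapunov_ac: "loc_abs_continuous (lyapunov B y l)"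
proof -
  have 1: "loc_abs_continuous (\<lambda>t. z t - y)" "loc_abs_continuous (\<lambda>t. lam t - l)"
    by (intro loc_abs_continuous_diff loc_abs_continuous_const z_ac lam_ac)+
  then have "loc_abs_continuous (\<lambda>t. B *v (z t - y))"
    by (intro loc_abs_continuous_linear[of "(*v) B"] matrix_vector_mul_bounded_linear)
  with 1 have "loc_abs_continuous (\<lambda>t. (1 / 2) *\<^sub>R ((z t - y) \<bullet> (B *v (z t - y))) + (1 / 2) *\<^sub>R ((lam t - l) \<bullet> (lam t - l)))"
    by (intro loc_abs_continuous_add loc_abs_continuous_scaleR loc_abs_continuous_inner)
  then show ?thesis by (simp add: lyapunov_def[abs_def])
qed

text \<open>The projection alters \<open>u $ k\<close> only where \<open>v $ k = 0\<close>, and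
  there it raises it while \<open>(v - l) $ k \<le> 0\<close>. In this way the discontinuity drops
  out of the Lyapunov estimate.\<close>

lemma pos_proj_inner_le:
  assumes "\<And>k. 0 \<le> v $ k" "\<And>k. 0 \<le> l $ k"
  shows "(v - l) \<bullet> pos_proj u v \<le> (v - l) \<bullet> u"
  unfolding inner_vec_def
proof (rule sum_mono)
  fix k
  show "(v - l) $ k \<bullet> pos_proj u v $ k \<le> (v - l) $ k \<bullet> u $ k"
  proof (cases "v $ k > 0")
    case False
    then have "v $ k = 0" using assms(1)[of k] by simp
    then show ?thesis using assms(2)[of k] by (simp add: pos_proj_def mult_left_mono)
  qed (simp add: pos_proj_def)
qed

text \<open>The primal part contributes minus the inner product of
  \<open>constr (z t) - constr y\<close> with \<open>lam t - l\<close>, the dual part at most that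
  of \<open>constr (z t)\<close> with \<open>lam t - l\<close>. What is left of the coupling is
  \<open>(lam t - l) \<bullet> constr y\<close>, where complementarity removes
  \<open>l\<close>.\<close>

lemma lyapunov_derivative:
  assumes "kkt y l" and B: "transpose B = B" "\<And>x. B *v (A *v x) = x"
  shows "AE t in lebesgue. 0 \<le> t \<longrightarrow>
    (\<exists>D\<le>- dissipation y (z t, lam t). (lyapunov B y l has_vector_derivative D) (at t within {0..}))"
  using flow
proof eventually_elim
  case (elim t)
  show ?case
  proof
    assume "0 \<le> t"
    define G where "G = lag_grad (z t) (lam t)"
    define F where "F = pos_proj (constr (z t)) (lam t)"
    have z': "((\<lambda>t. z t - y) has_vector_derivative - (A *v G)) (at t within {0..})"
      using elim \<open>0 \<le> t\<close> by (auto simp: G_def intro!: derivative_eq_intros)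
    have lam': "((\<lambda>t. lam t - l) has_vector_derivative F) (at t within {0..})"
      using elim \<open>0 \<le> t\<close> by (auto simp: F_def intro!: derivative_eq_intros)
    have Bz': "((\<lambda>t. B *v (z t - y)) has_vector_derivative - G) (at t within {0..})"
      using bounded_linear.has_vector_derivative[OF matrix_vector_mul_bounded_linear z', of B]
      by (simp add: B(2) linear_neg[OF matrix_vector_mul_linear])
    let ?D = "- ((z t - y) \<bullet> G) + (lam t - l) \<bullet> F"
    have "(z t - y) \<bullet> G = (A *v G) \<bullet> (B *v (z t - y))"
      using inner_matrix_vector_mult_transpose[of B "A *v G" "z t - y"] B by (simp add: inner_commute)
    then have D_eq: "?D = (1 / 2) * ((z t - y) \<bullet> - G + (- (A *v G)) \<bullet> (B *v (z t - y))) +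
        (1 / 2) * ((lam t - l) \<bullet> F + F \<bullet> (lam t - l))"
      by (simp add: inner_commute)
    have "(lyapunov B y l has_vector_derivative ?D) (at t within {0..})"
      unfolding lyapunov_def[abs_def] D_eq
      by (intro has_vector_derivative_add has_vector_derivative_mult_right
          bounded_bilinear.has_vector_derivative[OF bounded_bilinear_inner] z' lam' Bz')
    moreover have "?D \<le> - dissipation y (z t, lam t)"
    proof -
      have "G = Q *v (z t - y) + transpose C *v (lam t - l)"
        using lag_grad_diff[of "z t" "lam t" y l] assms(1) by (simp add: G_def kkt_def)
      then have "(z t - y) \<bullet> G = (z t - y) \<bullet> (Q *v (z t - y)) + (constr (z t) - constr y) \<bullet> (lam t - l)"
        by (simp add: inner_add_right constr_diff inner_matrix_vector_mult_transpose)
      moreover have "(lam t - l) \<bullet> F \<le> (lam t - l) \<bullet> constr (z t)"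
        unfolding F_def using assms(1) \<open>0 \<le> t\<close> by (intro pos_proj_inner_le lam_nonneg) (simp_all add: kkt_def)
      ultimately show ?thesis using assms(1)
        by (simp add: dissipation_def kkt_def inner_diff_left inner_diff_right inner_commute)
    qed
    ultimately show "\<exists>D\<le>- dissipation y (z t, lam t). (lyapunov B y l has_vector_derivative D) (at t within {0..})"
      by blast
  qed
qed

lemma lyapunov_convergent:
  assumes kkt: "kkt y l" and B: "transpose B = B" "\<And>x. B *v (A *v x) = x" "\<And>x. x \<noteq> 0 \<Longrightarrow> 0 < x \<bullet> (B *v x)"
  shows "\<exists>m. (lyapunov B y l \<longlongrightarrow> m) at_top" "\<And>t. 0 \<le> t \<Longrightarrow> lyapunov B y l t \<le> lyapunov B y l 0"
proof -
  have nonneg: "0 \<le> lyapunov B y l t" for t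
    using B(3)[of "z t - y"] by (cases "z t - y = 0") (simp_all add: lyapunov_def)
  have der: "AE t in lebesgue. 0 \<le> t \<longrightarrow> (\<exists>D\<le>0. (lyapunov B y l has_vector_derivative D) (at t within {0..}))"
    using lyapunov_derivative[OF kkt B(1,2)]
    by eventually_elim (meson dissipation_nonneg(2)[OF kkt] neg_le_0_iff_le order_trans)
  show "\<exists>m. (lyapunov B y l \<longlongrightarrow> m) at_top" "\<And>t. 0 \<le> t \<Longrightarrow> lyapunov B y l t \<le> lyapunov B y l 0"
    using loc_abs_continuous_nonincreasing_convergent[OF lyapunov_ac nonneg der] by blast+
qed

lemma trajectory_bounded: "bounded ((\<lambda>t. (z t, lam t)) ` {0..})"
proof -
  obtain y l where kkt: "kkt y l" using kkt_exists by blast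
  obtain B where B: "transpose B = B" "\<And>x. B *v (A *v x) = x" "\<And>x. x \<noteq> 0 \<Longrightarrow> 0 < x \<bullet> (B *v x)"
    using exists_inverse_A by blast
  obtain \<beta> where "0 < \<beta>" and \<beta>: "\<And>x. x \<in> UNIV \<Longrightarrow> \<beta> * (x \<bullet> x) \<le> x \<bullet> (B *v x)"
    by (rule positive_on_subspace_imp_coercive[OF subspace_UNIV, where M = B]) (simp_all add: B(3))
  define V where "V = lyapunov B y l 0"
  have "norm (z t, lam t) \<le> (norm y + sqrt (2 * V / \<beta>)) + (norm l + sqrt (2 * V))" if "0 \<le> t" for t
  proof -
    have V: "lyapunov B y l t \<le> V" unfolding V_def by (rule lyapunov_convergent(2)[OF kkt B that])
    have "\<beta> * ((z t - y) \<bullet> (z t - y)) \<le> 2 * V" "(lam t - l) \<bullet> (lam t - l) \<le> 2 * V"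
      using V \<beta>[OF UNIV_I, of "z t - y"] mult_nonneg_nonneg[OF less_imp_le[OF \<open>0 < \<beta>\<close>] inner_ge_zero[of "z t - y"]]
        inner_ge_zero[of "lam t - l"]
      unfolding lyapunov_def by linarith+
    then have "norm (z t - y) \<le> sqrt (2 * V / \<beta>)" "norm (lam t - l) \<le> sqrt (2 * V)"
      using \<open>0 < \<beta>\<close> by (simp_all add: norm_eq_sqrt_inner field_simps)
    moreover have "norm (z t) \<le> norm y + norm (z t - y)" "norm (lam t) \<le> norm l + norm (lam t - l)"
      by (simp_all add: norm_triangle_sub)
    moreover have "norm (z t, lam t) \<le> norm (z t) + norm (lam t)" by (rule norm_Pair_le)
    ultimately show ?thesis by linarith
  qed
  then show ?thesis by (auto simp: bounded_iff)
qed

lemma continuous_lag_grad: "continuous_on UNIV (\<lambda>x. A *v lag_grad (fst x) (snd x))"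
  unfolding lag_grad_def by (intro continuous_intros continuous_on_matrix_vector_mult)

text \<open>The right-hand side is discontinuous, but it is bounded along a bounded trajectory
  because the projection does not increase norms; so the trajectory is Lipschitz.\<close>

lemma trajectory_uniformly_continuous: "uniformly_continuous_on {0..} (\<lambda>t. (z t, lam t))"
proof -
  let ?x = "\<lambda>t. (z t, lam t)"
  have "bounded ((\<lambda>x. A *v lag_grad (fst x) (snd x)) ` ?x ` {0..})"
    by (rule continuous_image_bounded[OF trajectory_bounded continuous_lag_grad])
  then obtain b1 where b1: "\<And>t. 0 \<le> t \<Longrightarrow> norm (A *v lag_grad (z t) (lam t)) \<le> b1"
    by (force simp: bounded_iff)
  have "continuous_on UNIV (\<lambda>x::(real^'v) \<times> (real^'k). constr (fst x))"
    unfolding constr_def by (intro continuous_intros continuous_on_matrix_vector_mult)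
  from continuous_image_bounded[OF trajectory_bounded this]
  obtain b2 where b2: "\<And>t. 0 \<le> t \<Longrightarrow> norm (constr (z t)) \<le> b2"
    by (force simp: bounded_iff)
  show ?thesis
  proof (rule bounded_derivative_imp_uniformly_continuous_on[where c = "b1 + b2"])
    show "loc_abs_continuous ?x" by (rule loc_abs_continuous_Pair[OF z_ac lam_ac])
    show "AE t in lebesgue. 0 \<le> t \<longrightarrow> (\<exists>D. norm D \<le> b1 + b2 \<and> (?x has_vector_derivative D) (at t within {0..}))"
      using flow
    proof eventually_elim
      case (elim t)
      show ?case
      proof
        assume "0 \<le> t"
        let ?D = "(- (A *v lag_grad (z t) (lam t)), pos_proj (constr (z t)) (lam t))"
        have "(?x has_vector_derivative ?D) (at t within {0..})"
          using elim \<open>0 \<le> t\<close> by (intro has_vector_derivative_Pair) auto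
        moreover have "norm ?D \<le> b1 + b2"
          using norm_Pair_le[of "- (A *v lag_grad (z t) (lam t))" "pos_proj (constr (z t)) (lam t)"]
            b1[OF \<open>0 \<le> t\<close>] b2[OF \<open>0 \<le> t\<close>] norm_pos_proj_le[of "constr (z t)" "lam t"] by simp
        ultimately show "\<exists>D. norm D \<le> b1 + b2 \<and> (?x has_vector_derivative D) (at t within {0..})" by blast
      qed
    qed
  qed
qed

section \<open>Limits along the trajectory\<close>

lemma dissipation_tendsto:
  assumes kkt: "kkt y l"
  shows "((\<lambda>t. dissipation y (z t, lam t)) \<longlongrightarrow> 0) at_top"
proof (rule order_tendstoI)
  obtain B where B: "transpose B = B" "\<And>x. B *v (A *v x) = x" "\<And>x. x \<noteq> 0 \<Longrightarrow> 0 < x \<bullet> (B *v x)"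
    using exists_inverse_A by blast
  obtain m where m: "(lyapunov B y l \<longlongrightarrow> m) at_top" using lyapunov_convergent(1)[OF kkt B] by blast
  have "continuous_on UNIV (dissipation y)"
    unfolding dissipation_def by (intro continuous_intros continuous_on_matrix_vector_mult)
  from uniformly_continuous_on_compose_bounded[OF trajectory_uniformly_continuous trajectory_bounded this]
  show "\<forall>\<^sub>F t in at_top. dissipation y (z t, lam t) < r" if "0 < r" for r
    by (rule barbalat_eventually_less[OF lyapunov_ac m _ lyapunov_derivative[OF kkt B(1,2)] that])
  show "\<forall>\<^sub>F t in at_top. r < dissipation y (z t, lam t)" if "r < 0" for r
    using eventually_ge_at_top[of 0]
    by eventually_elim (use dissipation_nonneg(2)[OF kkt] that in force)
qed

text \<open>Conservation keeps \<open>z t - y\<close> in the orthogonal complement of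
  \<open>e\<close>, where \<open>Q\<close> is coercive; so the dissipation bounds the squared
  distance.\<close>

lemma z_tendsto:
  assumes kkt: "kkt y l" and "y \<bullet> e = z 0 \<bullet> e"
  shows "(z \<longlongrightarrow> y) at_top"
proof -
  obtain \<alpha> where "0 < \<alpha>" and \<alpha>: "\<And>x. x \<bullet> e = 0 \<Longrightarrow> \<alpha> * (x \<bullet> x) \<le> x \<bullet> (Q *v x)"
    using Q_coercive by blast
  have le: "(norm (z t - y))\<^sup>2 \<le> dissipation y (z t, lam t) / \<alpha>" if "0 \<le> t" for t
  proof -
    have "(z t - y) \<bullet> e = 0" using z_inner_e[OF that] assms(2) by (simp add: inner_diff_left)
    from \<alpha>[OF this] have "\<alpha> * (norm (z t - y))\<^sup>2 \<le> dissipation y (z t, lam t)"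
      using dissipation_nonneg(1)[OF kkt that] by (simp add: dissipation_def dot_square_norm)
    then show ?thesis using \<open>0 < \<alpha>\<close> by (simp add: field_simps)
  qed
  have "((\<lambda>t. dissipation y (z t, lam t) / \<alpha>) \<longlongrightarrow> 0 / \<alpha>) at_top"
    using \<open>0 < \<alpha>\<close> by (intro tendsto_divide dissipation_tendsto[OF kkt] tendsto_const) auto
  then have "((\<lambda>t. dissipation y (z t, lam t) / \<alpha>) \<longlongrightarrow> 0) at_top" by simp
  moreover have "\<forall>\<^sub>F t in at_top. norm ((norm (z t - y))\<^sup>2) \<le> dissipation y (z t, lam t) / \<alpha>"
    using eventually_ge_at_top[of 0] by eventually_elim (simp add: le)
  ultimately have "((\<lambda>t. (norm (z t - y))\<^sup>2) \<longlongrightarrow> 0) at_top"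
    by (rule Lim_null_comparison[rotated])
  then have "((\<lambda>t. sqrt ((norm (z t - y))\<^sup>2)) \<longlongrightarrow> sqrt 0) at_top" by (rule tendsto_real_sqrt)
  then have "((\<lambda>t. z t - y) \<longlongrightarrow> 0) at_top" by (simp add: tendsto_norm_zero_iff)
  then show ?thesis by (simp add: LIM_zero_iff)
qed

text \<open>The equation for z carries no projection, so its right-hand side is a continuous
  function of the state and hence uniformly continuous in time. This permits Barbalat's lemma with
  both signs.\<close>

lemma lag_grad_tendsto:
  assumes z: "(z \<longlongrightarrow> y) at_top"
  shows "((\<lambda>t. A *v lag_grad (z t) (lam t)) \<longlongrightarrow> 0) at_top"
proof (rule vec_tendstoI)
  fix i
  have ac: "loc_abs_continuous (\<lambda>t. z t $ i)"
    by (rule loc_abs_continuous_linear[of "\<lambda>v. v $ i", OF bounded_linear_vec_nth z_ac])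
  have lim: "((\<lambda>t. z t $ i) \<longlongrightarrow> y $ i) at_top" using z by (rule tendsto_vec_nth)
  have "continuous_on UNIV (\<lambda>x. (A *v lag_grad (fst x) (snd x)) $ i)"
    using continuous_lag_grad by (rule continuous_on_component)
  from uniformly_continuous_on_compose_bounded[OF trajectory_uniformly_continuous trajectory_bounded this]
  have uc: "uniformly_continuous_on {0..} (\<lambda>t. (A *v lag_grad (z t) (lam t)) $ i)" by simp
  have der: "AE t in lebesgue. 0 \<le> t \<longrightarrow>
      ((\<lambda>t. z t $ i) has_vector_derivative - ((A *v lag_grad (z t) (lam t)) $ i)) (at t within {0..})"
    using flow
  proof eventually_elim
    case (elim t)
    then show ?case
      using bounded_linear.has_vector_derivative[OF bounded_linear_vec_nth[of i], of z
          "- (A *v lag_grad (z t) (lam t))" "at t within {0..}"] by simp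
  qed
  have der_neg: "AE t in lebesgue. 0 \<le> t \<longrightarrow>
      ((\<lambda>t. - z t $ i) has_vector_derivative (A *v lag_grad (z t) (lam t)) $ i) (at t within {0..})"
    using der by eventually_elim (use has_vector_derivative_minus in force)
  have "((\<lambda>t. (A *v lag_grad (z t) (lam t)) $ i) \<longlongrightarrow> 0) at_top"
  proof (rule order_tendstoI)
    show "\<forall>\<^sub>F t in at_top. (A *v lag_grad (z t) (lam t)) $ i < r" if "0 < r" for r
    proof (rule barbalat_eventually_less[OF ac lim uc _ that])
      show "AE t in lebesgue. 0 \<le> t \<longrightarrow> (\<exists>D\<le>- ((A *v lag_grad (z t) (lam t)) $ i).
          ((\<lambda>t. z t $ i) has_vector_derivative D) (at t within {0..}))"
        using der by eventually_elim blast
    qed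
    show "\<forall>\<^sub>F t in at_top. r < (A *v lag_grad (z t) (lam t)) $ i" if "r < 0" for r
    proof -
      have "\<forall>\<^sub>F t in at_top. - ((A *v lag_grad (z t) (lam t)) $ i) < - r"
      proof (rule barbalat_eventually_less[OF loc_abs_continuous_minus[OF ac] tendsto_minus[OF lim]
            uniformly_continuous_on_minus[OF uc]])
        show "AE t in lebesgue. 0 \<le> t \<longrightarrow> (\<exists>D\<le>- (- ((A *v lag_grad (z t) (lam t)) $ i)).
            ((\<lambda>t. - z t $ i) has_vector_derivative D) (at t within {0..}))"
          using der_neg by eventually_elim auto
      qed (use that in simp)
      then show ?thesis by simp
    qed
  qed
  then show "((\<lambda>t. (A *v lag_grad (z t) (lam t)) $ i) \<longlongrightarrow> 0 $ i) at_top" by simp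
qed

text \<open>Every limit point of the bounded multiplier trajectory is a multiplier of the limit of \<open>z\<close>;
  the Lyapunov function centred at that multiplier then forces convergence.\<close>

theorem saddle_flow_convergent:
  assumes kkt: "kkt y l" and "y \<bullet> e = z 0 \<bullet> e"
  obtains l' where "kkt y l'" "(z \<longlongrightarrow> y) at_top" "(lam \<longlongrightarrow> l') at_top"
proof -
  have z: "(z \<longlongrightarrow> y) at_top" by (rule z_tendsto[OF assms])
  \<comment> \<open>Once z converges to \<open>y\<close>, the quadratic part of the dissipation
    vanishes in the limit and only complementarity is left.\<close>
  have comp: "((\<lambda>t. lam t \<bullet> constr y) \<longlongrightarrow> 0) at_top"
  proof -
    have "((\<lambda>t. (z t - y) \<bullet> (Q *v (z t - y)) - dissipation y (z t, lam t)) \<longlongrightarrow> (y - y) \<bullet> (Q *v (y - y)) - 0) at_top"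
      by (intro tendsto_intros tendsto_matrix_vector_mult z dissipation_tendsto[OF kkt])
    then show ?thesis by (simp add: dissipation_def)
  qed
  have "bounded (range (\<lambda>n. lam (real n)))"
  proof -
    have "range (\<lambda>n. lam (real n)) \<subseteq> snd ` (\<lambda>t. (z t, lam t)) ` {0..}" by force
    then show ?thesis using bounded_snd[OF trajectory_bounded] bounded_subset by blast
  qed
  then obtain l' r where r: "strict_mono (r :: nat \<Rightarrow> nat)" and l': "((\<lambda>n. lam (real n)) \<circ> r) \<longlonglongrightarrow> l'"
    using bounded_imp_convergent_subsequence by blast
  have sub: "filterlim (\<lambda>n. real (r n)) at_top sequentially"
    using filterlim_compose[OF filterlim_real_sequentially filterlim_subseq[OF r]] .
  have lamr: "(\<lambda>n. lam (real (r n))) \<longlonglongrightarrow> l'" using l' by (simp add: o_def)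
  have zr: "(\<lambda>n. z (real (r n))) \<longlonglongrightarrow> y" using filterlim_compose[OF z sub] .
  have "kkt y l'"
    unfolding kkt_def
  proof (intro conjI allI)
    show "0 \<le> l' $ k" for k
      by (rule LIMSEQ_le_const[OF tendsto_vec_nth[OF lamr]]) (simp add: lam_nonneg)
    show "constr y $ k \<le> 0" for k using kkt by (simp add: kkt_def)
    have "(\<lambda>n. lam (real (r n)) \<bullet> constr y) \<longlonglongrightarrow> l' \<bullet> constr y"
      by (intro tendsto_intros tendsto_matrix_vector_mult lamr)
    then show "l' \<bullet> constr y = 0" using LIMSEQ_unique filterlim_compose[OF comp sub] by blast
    have "(\<lambda>n. A *v lag_grad (z (real (r n))) (lam (real (r n)))) \<longlonglongrightarrow> A *v lag_grad y l'"
      unfolding lag_grad_def by (intro tendsto_intros tendsto_matrix_vector_mult lamr zr)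
    then have "A *v lag_grad y l' = 0"
      using LIMSEQ_unique filterlim_compose[OF lag_grad_tendsto[OF z] sub] by blast
    then show "lag_grad y l' = 0" using A_pos[of "lag_grad y l'"] by force
  qed
  obtain B where B: "transpose B = B" "\<And>x. B *v (A *v x) = x" "\<And>x. x \<noteq> 0 \<Longrightarrow> 0 < x \<bullet> (B *v x)"
    using exists_inverse_A by blast
  obtain m where m: "(lyapunov B y l' \<longlongrightarrow> m) at_top"
    using lyapunov_convergent(1)[OF \<open>kkt y l'\<close> B] by blast
  have "(\<lambda>n. lyapunov B y l' (real (r n))) \<longlonglongrightarrow>
      (1 / 2) * ((y - y) \<bullet> (B *v (y - y))) + (1 / 2) * ((l' - l') \<bullet> (l' - l'))"
    unfolding lyapunov_def by (intro tendsto_intros tendsto_matrix_vector_mult lamr zr)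
  \<comment> \<open>The limit over all times exists, so the subsequence determines it.\<close>
  then have "m = 0" using LIMSEQ_unique[OF _ filterlim_compose[OF m sub]] by simp
  have "((\<lambda>t. 2 * lyapunov B y l' t) \<longlongrightarrow> 2 * 0) at_top"
    using m \<open>m = 0\<close> by (intro tendsto_intros) simp
  then have "((\<lambda>t. 2 * lyapunov B y l' t) \<longlongrightarrow> 0) at_top" by simp
  moreover have "\<forall>\<^sub>F t in at_top. norm ((norm (lam t - l'))\<^sup>2) \<le> 2 * lyapunov B y l' t"
  proof (rule always_eventually, rule allI)
    fix t
    have "0 \<le> (z t - y) \<bullet> (B *v (z t - y))" using B(3)[of "z t - y"] by (cases "z t - y = 0") auto
    then show "norm ((norm (lam t - l'))\<^sup>2) \<le> 2 * lyapunov B y l' t"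
      by (simp add: lyapunov_def dot_square_norm)
  qed
  ultimately have "((\<lambda>t. (norm (lam t - l'))\<^sup>2) \<longlongrightarrow> 0) at_top"
    by (rule Lim_null_comparison[rotated])
  then have "((\<lambda>t. sqrt ((norm (lam t - l'))\<^sup>2)) \<longlongrightarrow> sqrt 0) at_top" by (rule tendsto_real_sqrt)
  then have "((\<lambda>t. lam t - l') \<longlongrightarrow> 0) at_top" by (simp add: tendsto_norm_zero_iff)
  then have "(lam \<longlongrightarrow> l') at_top" by (simp add: LIM_zero_iff)
  then show thesis using that \<open>kkt y l'\<close> z by blast
qed

end

section \<open>Laplacians and the reduced Hessian\<close>

text \<open>In this difference form constants visibly lie in the kernel, and at a maximum of
  \<open>x\<close> the summands all have the same sign.\<close>

lemma laplacian_mult_nth: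
  fixes E :: "('v::finite \<times> 'v) set"
  assumes "irrefl E"
  shows "(laplacian E w *v x) $ i = (\<Sum>k | (i, k) \<in> E. w i k * (x $ i - x $ k))"
proof -
  have "(i, i) \<notin> E" using assms by (simp add: irrefl_def)
  have "(laplacian E w *v x) $ i =
      (\<Sum>j\<in>UNIV. (if j = i then (\<Sum>k | (i, k) \<in> E. w i k) * x $ i else 0) + (if (i, j) \<in> E then - w i j * x $ j else 0))"
    unfolding matrix_vector_mult_def laplacian_def using \<open>(i, i) \<notin> E\<close>
    by (auto intro!: sum.cong)
  also have "\<dots> = (\<Sum>k | (i, k) \<in> E. w i k) * x $ i + (\<Sum>k | (i, k) \<in> E. - w i k * x $ k)"
    by (simp add: sum.distrib sum.If_cases)
  also have "\<dots> = (\<Sum>k | (i, k) \<in> E. w i k * (x $ i - x $ k))"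
    by (simp add: sum_distrib_right sum_negf right_diff_distrib sum_subtractf)
  finally show ?thesis .
qed

lemma transpose_laplacian:
  assumes "weighted_graph E w"
  shows "transpose (laplacian E w) = laplacian E w"
  using assms unfolding weighted_graph_def sym_def
  by (auto simp: transpose_def laplacian_def vec_eq_iff)

lemma laplacian_mult_const:
  assumes "irrefl E"
  shows "laplacian E w *v (\<chi> i. s) = 0"
  by (simp add: vec_eq_iff laplacian_mult_nth[OF assms])

text \<open>Maximum principle: the set where \<open>x\<close> attains its maximum is closed under adjacency.\<close>

lemma laplacian_kernel:
  fixes E :: "('v::finite \<times> 'v) set"
  assumes graph: "weighted_graph E w" "graph_connected E" and 0: "laplacian E w *v x = 0"
  shows "\<exists>s. x = (\<chi> i. s)"
proof -
  have irr: "irrefl E" and w: "\<And>i k. (i, k) \<in> E \<Longrightarrow> 0 < w i k"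
    using graph(1) by (auto simp: weighted_graph_def)
  define s where "s = Max (range (($) x))"
  have le: "x $ k \<le> s" for k unfolding s_def by (rule Max_ge) auto
  have "s \<in> range (($) x)" unfolding s_def by (rule Max_in) auto
  then obtain i where i: "x $ i = s" by auto
  have "x $ j = s" for j
  proof -
    have "(i, j) \<in> E\<^sup>*" using graph(2) by (simp add: graph_connected_def)
    then show "x $ j = s"
    proof induction
      case (step j k)
      have "(\<Sum>k | (j, k) \<in> E. w j k * (x $ j - x $ k)) = 0"
        using 0 laplacian_mult_nth[OF irr, of w x j] by simp
      moreover have "0 \<le> w j k * (x $ j - x $ k)" if "(j, k) \<in> E" for k
        using w[OF that] le[of k] step.IH by simp
      ultimately have "w j k * (x $ j - x $ k) = 0"
        using step.hyps(2) by (subst (asm) sum_nonneg_eq_0_iff) auto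
      then show ?case using w[OF step.hyps(2)] step.IH by simp
    qed (rule i)
  qed
  then show ?thesis by (intro exI[of _ s]) (simp add: vec_eq_iff)
qed

section \<open>The orthonormal basis and the spectral bound\<close>

lemma sum_option: "(\<Sum>i\<in>UNIV. f i) = f None + (\<Sum>k\<in>UNIV. f (Some k))"
  for f :: "'m::finite option \<Rightarrow> 'b::comm_monoid_add"
  unfolding UNIV_option_conv by (subst sum.insert) (auto simp: sum.reindex)

text \<open>The matrix times its transpose is the orthogonal projection onto the zero-sum vectors.
  With \<open>h = sqrt n\<close> the radicand is the square of \<open>h * (1 + h)\<close>, so
  \<open>r * (h * (1 + h)) = 1\<close> and the rest is polynomial algebra.\<close>

lemma ortho_basis_transpose_mult:
  fixes x :: "real^('m::finite option)"
  assumes "(\<Sum>i\<in>UNIV. x $ i) = 0"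
  shows "(ortho_basis :: real^'m^('m option)) *v (transpose ortho_basis *v x) = x"
proof -
  define n where "n = real CARD('m option)"
  define h where "h = sqrt n"
  define r where "r = 1 / (h * (1 + h))"
  have n1: "real CARD('m) = n - 1" by (simp add: n_def card_UNIV_option)
  have "n > 0" by (simp add: n_def)
  then have "h > 0" and n: "n = h * h" by (simp_all add: h_def)
  have "n * (n + 1 + 2 * h) = (h * (1 + h))\<^sup>2"
    using \<open>h > 0\<close> by (simp add: n power2_eq_square algebra_simps)
  then have r: "1 / sqrt (n * (n + 1 + 2 * h)) = r"
    using \<open>h > 0\<close> by (simp add: r_def)
  have rh: "r * (h * (1 + h)) = 1" using \<open>h > 0\<close> by (simp add: r_def)
  have U_None: "ortho_basis $ None $ j = - r * (1 + h)" for j :: 'm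
    unfolding ortho_basis_def Let_def n_def[symmetric] h_def[symmetric] r by simp
  have U_Some: "ortho_basis $ Some k $ j = - r + (if j = k then r * (n + h) else 0)" for j k :: 'm
    unfolding ortho_basis_def Let_def n_def[symmetric] h_def[symmetric] r
    by (simp add: algebra_simps)
  define s where "s = (\<Sum>k\<in>UNIV. x $ Some k)"
  have x_None: "x $ None = - s" using assms by (simp add: sum_option s_def)
  define v where "v = transpose ortho_basis *v x"
  have v: "v $ j = r * h * s + r * (n + h) * x $ Some j" for j :: 'm
  proof -
    have "v $ j = ortho_basis $ None $ j * x $ None + (\<Sum>k\<in>UNIV. ortho_basis $ Some k $ j * x $ Some k)"
      unfolding v_def matrix_vector_mult_def transpose_def by (simp add: sum_option)
    also have "(\<Sum>k\<in>UNIV. ortho_basis $ Some k $ j * x $ Some k) = - r * s + r * (n + h) * x $ Some j"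
      by (simp add: U_Some left_diff_distrib sum_subtractf sum_negf s_def sum_distrib_left if_distrib[of "\<lambda>c. c * _"] cong: if_cong)
    finally show ?thesis by (simp add: U_None x_None algebra_simps)
  qed
  have sum_v: "(\<Sum>j\<in>UNIV. v $ j) = r * s * n * (1 + h)"
    by (simp add: v sum.distrib s_def[symmetric] n1 flip: sum_distrib_left) (simp add: algebra_simps n)
  have "(ortho_basis *v v) $ i = x $ i" for i
  proof (cases i)
    case None
    have "(ortho_basis *v v) $ None = - r * (1 + h) * (\<Sum>j\<in>UNIV. v $ j)"
      unfolding matrix_vector_mult_def by (simp add: U_None sum_distrib_left)
    also have "\<dots> = - s * (r * (h * (1 + h))) * (r * (h * (1 + h)))" by (simp add: sum_v n)
    finally show ?thesis by (simp add: None rh x_None)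
  next
    case (Some k)
    have "(ortho_basis *v v) $ Some k = - r * (\<Sum>j\<in>UNIV. v $ j) + r * (n + h) * v $ k"
      unfolding matrix_vector_mult_def
      by (simp add: U_Some left_diff_distrib sum_subtractf sum_negf sum_distrib_left if_distrib[of "\<lambda>c. c * _"] cong: if_cong)
    \<comment> \<open>Here \<open>n + h = h * (1 + h)\<close>, and the terms containing
      \<open>s\<close> cancel.\<close>
    also have "\<dots> = (r * (h * (1 + h))) * (r * (h * (1 + h))) * x $ Some k"
      unfolding sum_v v[of k] by (simp add: n algebra_simps)
    finally show ?thesis by (simp add: Some rh)
  qed
  then show ?thesis by (simp add: vec_eq_iff v_def)
qed

text \<open>With \<open>x = y + s \<one>\<close>, \<open>y \<bottom> \<one>\<close>, the vector \<open>v = U\<^sup>T y\<close> satisfies \<open>U v = y\<close> and \<open>\<parallel>v\<parallel> = \<parallel>y\<parallel>\<close>, hence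
  \<open>x \<bullet> L H L x = v \<bullet> M v \<le> (1 + \<epsilon>) \<parallel>y\<parallel>\<^sup>2 < 2 \<parallel>x\<parallel>\<^sup>2\<close>.\<close>

lemma hessian_less_two:
  fixes L H :: "real^('m::finite option)^('m option)"
  assumes L_sym: "transpose L = L" and L_one: "L *v (\<chi> i. 1) = 0"
    and "\<epsilon> < 1" and le: "- \<epsilon> *\<^sub>R mat 1 \<preceq>\<^sub>L mat 1 - reduced_hessian L H" and "x \<noteq> 0"
  shows "x \<bullet> ((L ** H ** L) *v x) < 2 * (x \<bullet> x)"
proof -
  define e :: "real^('m option)" where "e = (\<chi> i. 1)"
  define s where "s = (x \<bullet> e) / (e \<bullet> e)"
  define y where "y = x - s *\<^sub>R e"
  have e_pos: "e \<bullet> e > 0" by (simp add: e_def inner_vec_def)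
  have ye: "y \<bullet> e = 0" using e_pos by (simp add: y_def s_def inner_diff_left)
  have x: "x = y + s *\<^sub>R e" by (simp add: y_def)
  have xx: "x \<bullet> x = y \<bullet> y + s * s * (e \<bullet> e)"
    using ye by (simp add: x inner_add_left inner_add_right inner_commute)
  have Lx: "L *v x = L *v y"
    using L_one by (simp add: x matrix_vector_right_distrib matrix_vector_mult_scaleR e_def)
  define v where "v = transpose ortho_basis *v y"
  have Uv: "ortho_basis *v v = y"
    unfolding v_def by (rule ortho_basis_transpose_mult) (use ye in \<open>simp add: e_def inner_vec_def\<close>)
  have vv: "v \<bullet> v = y \<bullet> y"
    using inner_matrix_vector_mult_transpose[of ortho_basis v y] Uv v_def by simp
  have "0 \<le> v \<bullet> ((mat 1 - reduced_hessian L H - - \<epsilon> *\<^sub>R mat 1) *v v)"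
    using le unfolding loewner_le_def psd_def by blast
  then have "v \<bullet> (reduced_hessian L H *v v) \<le> (1 + \<epsilon>) * (v \<bullet> v)"
    by (simp add: matrix_vector_mult_diff_rdistrib matrix_vector_mult_add_rdistrib
        scaleR_matrix_vector_assoc[symmetric] inner_add_right inner_diff_right algebra_simps)
  moreover have "v \<bullet> (reduced_hessian L H *v v) = x \<bullet> ((L ** H ** L) *v x)"
  proof -
    have "v \<bullet> (reduced_hessian L H *v v) = v \<bullet> (transpose ortho_basis *v (L *v (H *v (L *v y))))"
      by (simp add: reduced_hessian_def matrix_vector_mul_assoc[symmetric] Uv del: transpose_matrix_vector)
    also have "\<dots> = (L *v y) \<bullet> (H *v (L *v y))"
      using inner_matrix_vector_mult_transpose[of ortho_basis v "L *v (H *v (L *v y))"]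
        inner_matrix_vector_mult_transpose[of L y "H *v (L *v y)"] Uv L_sym by simp
    also have "\<dots> = x \<bullet> ((L ** H ** L) *v x)"
      using inner_matrix_vector_mult_transpose[of L x "H *v (L *v x)"] L_sym Lx
      by (simp add: matrix_vector_mul_assoc[symmetric])
    finally show ?thesis .
  qed
  ultimately have "x \<bullet> ((L ** H ** L) *v x) \<le> (1 + \<epsilon>) * (y \<bullet> y)" by (simp add: vv)
  also have "\<dots> < 2 * (x \<bullet> x)"
  proof (cases "y = 0")
    case True
    then have "s \<noteq> 0" using x \<open>x \<noteq> 0\<close> by auto
    then show ?thesis using True \<open>x \<noteq> 0\<close> by simp
  next
    case False
    have "(1 + \<epsilon>) * (y \<bullet> y) < 2 * (y \<bullet> y)" using False \<open>\<epsilon> < 1\<close> by (intro mult_strict_right_mono) auto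
    also have "\<dots> \<le> 2 * (x \<bullet> x)" using e_pos by (simp add: xx)
    finally show ?thesis .
  qed
  finally show ?thesis .
qed

section \<open>Convergence\<close>

theorem theorem3:
  fixes E :: "('m::finite option \<times> 'm option) set"
    and w :: "'m option \<Rightarrow> 'm option \<Rightarrow> real"
    and L H :: "real^('m option)^('m option)"
    and d \<epsilon> :: real
    and x0 a b xlo xhi :: "real^('m option)"
    and f :: "'m option \<Rightarrow> real \<Rightarrow> real"
    and g :: "real^('m option) \<Rightarrow> real"
    and P :: "real^('m option) \<Rightarrow> real^('m option + 'm option)"
    and q :: nat
    and A :: "real^('m option)^('m option)"
    and z :: "real \<Rightarrow> real^('m option)"
    and lam :: "real \<Rightarrow> real^('m option + 'm option)"
  assumes graph: "weighted_graph E w" "graph_connected E"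
    and L: "L = laplacian E w"
    and x0: "(\<Sum>i\<in>UNIV. x0 $ i) = d"
    and a: "\<And>i. a $ i > 0"
    and f: "\<And>i x. f i x = 1 / 2 * a $ i * x\<^sup>2 + b $ i * x"
    and H: "H = diag_mat a"
    and g: "\<And>y. g y = (\<Sum>i\<in>UNIV. f i (x0 $ i + (L *v y) $ i))"
    and eps: "\<epsilon> < 1"
      "- \<epsilon> *\<^sub>R mat 1 \<preceq>\<^sub>L mat 1 - reduced_hessian L H"
      "mat 1 - reduced_hessian L H \<preceq>\<^sub>L \<epsilon> *\<^sub>R mat 1"
    and P: "\<And>y. P y = (\<chi> k. case k of
                Inl i \<Rightarrow> (xlo - x0 - L *v y) $ i
              | Inr i \<Rightarrow> (x0 + L *v y - xhi) $ i)"
    and slater: "\<exists>y. \<forall>k. P y $ k < 0"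
    and A: "A = (\<Sum>p=0..q. mat_pow (mat 1 - L ** H ** L) p)"
    and sol: "saddle_flow_solution A (lagrangian g P) z lam"
    and init: "\<And>k. 0 \<le> lam 0 $ k"
  shows "\<exists>zs ls. optimal_point g P zs ls
           \<and> (z \<longlongrightarrow> zs) at_top \<and> (lam \<longlongrightarrow> ls) at_top
           \<and> (\<Sum>i\<in>UNIV. zs $ i) = (\<Sum>i\<in>UNIV. z 0 $ i)
           \<and> (\<forall>zs' ls'. optimal_point g P zs' ls'
                 \<and> (\<Sum>i\<in>UNIV. zs' $ i) = (\<Sum>i\<in>UNIV. z 0 $ i) \<longrightarrow> zs' = zs)"
proof -
  let ?Q = "L ** H ** L"
  define e :: "real^('m option)" where "e = (\<chi> i. 1)"
  \<comment> \<open>Expanding each \<open>f i\<close> at \<open>x0 $ i\<close>, the part linear in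
    \<open>L *v y\<close> has coefficients \<open>H *v x0 + b\<close>, and the constant part is
    \<open>k0\<close>.\<close>
  define c where "c = L *v (H *v x0 + b)"
  define C :: "real^('m option)^('m option + 'm option)"
    where "C = (\<chi> k. case k of Inl i \<Rightarrow> - (L $ i) | Inr i \<Rightarrow> L $ i)"
  define p :: "real^('m option + 'm option)"
    where "p = (\<chi> k. case k of Inl i \<Rightarrow> (xlo - x0) $ i | Inr i \<Rightarrow> (x0 - xhi) $ i)"
  define k0 where "k0 = (\<Sum>i\<in>UNIV. f i (x0 $ i))"
  have e_inner: "y \<bullet> e = (\<Sum>i\<in>UNIV. y $ i)" for y by (simp add: e_def inner_vec_def)
  have irr: "irrefl E" using graph(1) by (simp add: weighted_graph_def)
  have L_sym: "transpose L = L" unfolding L by (rule transpose_laplacian[OF graph(1)])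
  have H_sym: "transpose H = H" unfolding H by (rule transpose_diag_mat)
  have L_e: "L *v e = 0" unfolding L e_def by (rule laplacian_mult_const[OF irr])
  have Q_sym: "transpose ?Q = ?Q" by (simp add: matrix_transpose_mul L_sym H_sym matrix_mul_assoc)
  have Q_e: "?Q *v e = 0" by (simp add: matrix_vector_mul_assoc[symmetric] L_e)
  have Q_inner: "y \<bullet> (?Q *v y') = (\<Sum>i\<in>UNIV. a $ i * (L *v y) $ i * (L *v y') $ i)" for y y'
    using inner_matrix_vector_mult_transpose[of L y "H *v (L *v y')"] L_sym
    by (simp add: matrix_vector_mul_assoc[symmetric] H inner_vec_def diag_mat_mult_nth mult_ac)
  let ?S = "mat 1 - ?Q"
  have S_sym: "transpose ?S = ?S"
    using Q_sym by (simp add: transpose_def vec_eq_iff mat_def)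
  have S_pos: "0 < y \<bullet> y + y \<bullet> (?S *v y)" if "y \<noteq> 0" for y
    using hessian_less_two[OF L_sym L_e[unfolded e_def] eps(1,2) that]
    by (simp add: matrix_vector_mult_diff_rdistrib inner_diff_right)
  have C_mult: "(C *v y) $ k = (case k of Inl i \<Rightarrow> - ((L *v y) $ i) | Inr i \<Rightarrow> (L *v y) $ i)" for y k
    by (cases k) (simp_all add: C_def matrix_vector_mult_def sum_negf)
  \<comment> \<open>The eigenvalue is q + 1, the number of powers in the sum: L H L annihilates
    \<open>e\<close>, so each power fixes it.\<close>
  interpret preconditioned_qp ?Q A C c e p k0 "real (Suc q)"
  proof
    show "transpose ?Q = ?Q" by (rule Q_sym)
    show "transpose A = A" unfolding A transpose_sum by (simp add: transpose_mat_pow[OF S_sym])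
    show "0 < y \<bullet> (A *v y)" if "y \<noteq> 0" for y
      using sum_mat_pow_pos[OF S_sym S_pos that, of q]
      by (simp add: A sum_matrix_vector_mult inner_sum_right atMost_atLeast0)
    show "e \<noteq> 0" by (simp add: e_def vec_eq_iff)
    show "?Q *v e = 0" by (rule Q_e)
    show "C *v e = 0" by (simp add: vec_eq_iff C_mult L_e split: sum.split)
    show "c \<bullet> e = 0"
      using inner_matrix_vector_mult_transpose[of L "H *v x0 + b" e] L_sym L_e by (simp add: c_def)
    show "0 < y \<bullet> (?Q *v y)" if "y \<bullet> e = 0" "y \<noteq> 0" for y
    proof -
      have "L *v y \<noteq> 0"
      proof
        assume "L *v y = 0"
        then obtain s where s: "y = (\<chi> i. s)" using laplacian_kernel[OF graph] L by blast
        then have "s = 0" using that(1) by (simp add: e_inner)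
        then show False using s that(2) by (simp add: vec_eq_iff)
      qed
      then obtain i where "(L *v y) $ i \<noteq> 0" by (auto simp: vec_eq_iff)
      then have "0 < (\<Sum>i\<in>UNIV. a $ i * ((L *v y) $ i)\<^sup>2)"
        using a by (intro sum_pos2[of UNIV i]) (auto simp: less_imp_le)
      then show ?thesis by (simp add: Q_inner power2_eq_square mult_ac)
    qed
    show "A *v e = real (Suc q) *\<^sub>R e"
    proof -
      have "mat_pow ?S p *v e = e" for p
        by (induction p)
           (simp_all add: matrix_vector_mul_assoc[symmetric] matrix_vector_mult_diff_rdistrib L_e)
      then show ?thesis by (simp add: A sum_matrix_vector_mult sum_constant_scaleR del: sum_constant)
    qed
  qed
  have g_eq: "g = cost"
  proof
    fix y
    have "c \<bullet> y = (\<Sum>i\<in>UNIV. (a $ i * x0 $ i + b $ i) * (L *v y) $ i)"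
      using inner_matrix_vector_mult_transpose[of L "H *v x0 + b" y] L_sym
      by (simp add: c_def inner_vec_def H diag_mat_mult_nth)
    then have "cost y = (\<Sum>i\<in>UNIV. a $ i * (L *v y) $ i * (L *v y) $ i / 2 +
        (a $ i * x0 $ i + b $ i) * (L *v y) $ i + f i (x0 $ i))"
      unfolding cost_def by (simp add: Q_inner k0_def sum.distrib sum_divide_distrib)
    also have "\<dots> = g y"
      unfolding g f by (rule sum.cong) (simp_all add: power2_eq_square field_simps)
    finally show "g y = cost y" by simp
  qed
  have P_eq: "P = constr"
  proof
    fix y
    have "P y $ k = (C *v y) $ k + p $ k" for k
      by (cases k) (simp_all add: P C_mult p_def)
    then show "P y = constr y" by (simp add: constr_def vec_eq_iff)
  qed
  obtain y0 where y0: "\<And>k. constr y0 $ k < 0" using slater unfolding P_eq by blast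
  \<comment> \<open>The conserved sum selects the limit in advance: by \<open>kkt_unique\<close>
    only one primal point has this sum.\<close>
  obtain zs l where zs: "kkt zs l" "zs \<bullet> e = z 0 \<bullet> e" using exists_kkt[OF y0] by blast
  interpret preconditioned_saddle_flow ?Q A C c e p k0 "real (Suc q)" z lam
  proof
    show "loc_abs_continuous z" "loc_abs_continuous lam"
      using sol by (auto simp: saddle_flow_solution_def loc_abs_continuous_def)
    show "AE t in lebesgue. 0 \<le> t \<longrightarrow>
        (z has_vector_derivative - (A *v lag_grad (z t) (lam t))) (at t within {0..}) \<and>
        (lam has_vector_derivative pos_proj (constr (z t)) (lam t)) (at t within {0..})"
      using sol unfolding saddle_flow_solution_def g_eq P_eq grad_lagrangian_primal grad_lagrangian_dual
      by blast
  qed (use init zs in auto)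
  obtain ls where ls: "kkt zs ls" "(z \<longlongrightarrow> zs) at_top" "(lam \<longlongrightarrow> ls) at_top"
    using saddle_flow_convergent[OF zs] by blast
  have unique: "zs' = zs" if "kkt zs' ls' \<and> (\<Sum>i\<in>UNIV. zs' $ i) = (\<Sum>i\<in>UNIV. z 0 $ i)" for zs' ls'
    using kkt_unique[of zs' ls' zs l] that zs by (simp add: e_inner)
  have "(\<Sum>i\<in>UNIV. zs $ i) = (\<Sum>i\<in>UNIV. z 0 $ i)" using zs(2) by (simp add: e_inner)
  then show ?thesis
    unfolding g_eq P_eq optimal_point_iff_kkt
    by (intro exI[of _ zs] exI[of _ ls] conjI allI impI ls) (assumption, erule unique)
qed

end
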